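(* Let $\kappa>\max(\kappa_0,|T|)$ be a small cardinal. Then $\kappa$-lovely pairs exist. Moreover, if $\langle C,P(C)\rangle$ is an $\mathcal L^2$-structure, where $P(C)\subseteq C\subset\mathfrak C$, $C$ is small (with the $\mathcal L$-structure induced from $\mathfrak C$), and $P(C)$ is closed in $C$ (i.e. $\mathrm{cl}(P(C))\cap C=P(C)$), then there exists a $\kappa$-lovely pair $M_P=\langle M,P(M)\rangle$ such that $\langle C,P(C)\rangle$ is an $\mathcal L^2$-substructure of $M_P$ and $P(M)\downarrow_{P(C)}C$.
   Context: $T$ is a complete first-order theory in a language $\mathcal L$ and $\mathfrak C$ is a monster model of $T$; "small" means of cardinality smaller than the monstrosity of $\mathfrak C$ (its degree of saturation and strong homogeneity); tuples have small length. Juxtaposition denotes union, and tuples are identified with their sets of entries. An independence relation on $\mathfrak C$ is a ternary relation $A\downarrow_C B$ on small subsets of $\mathfrak C$ such that for all small $A,B,C,D$: (Invariance) $A\downarrow_B C\Rightarrow\sigma(A)\downarrow_{\sigma(B)}\sigma(C)$ for $\sigma\in\mathrm{Aut}(\mathfrak C)$; (Normality) $A\downarrow_C B\Rightarrow AC\downarrow_C B$; (Symmetry) $A\downarrow_B C\Rightarrow C\downarrow_B A$; (Transitivity) if $B\subseteq C\subseteq D$, then $A\downarrow_B D$ iff $A\downarrow_B C$ and $A\downarrow_C D$; (Finite character) $A\downarrow_B C$ iff $A_0\downarrow_B C$ for all finite $A_0\subseteq A$; (Extension) there is $A'\equiv_B A$ with $A'\downarrow_B C$; (Local character) there is a small cardinal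 $\lambda$ depending only on $\downarrow$ such that for all small $A,C$ there is $C_0\subseteq C$ with $|C_0|<\lambda+|A|^+$ and $A\downarrow_{C_0}C$. For arbitrary $A,B,C\subseteq\mathfrak C$, $A\downarrow_B C$ means: for all small $A'\subseteq A$, $B'\subseteq B$, $C'\subseteq C$ there is a small $B''$ with $B'\subseteq B''\subseteq B$ and $A'\downarrow_{B''}C'$. Fix an independence relation $\downarrow$ on $\mathfrak C$. $\kappa_0$ is the least regular cardinal $\mu$ such that for every finite tuple $\bar a$ and small set $B$ there is $B_0\subseteq B$ with $|B_0|<\mu$ and $\bar a\downarrow_{B_0}B$. For $A\subseteq\mathfrak C$, $\mathrm{cl}(A)=\{c\in\mathfrak C: c\downarrow_A c\}$. $\mathcal L^2=\mathcal L\cup\{P\}$ with $P$ a new unary predicate; $T^2$ is the theory of all expansions of $T$ to $\mathcal L^2$. A superscript 1 (resp. 2) on a model-theoretic notion refers to $\mathcal L$ (resp. $\mathcal L^2$). Models of $T$ are elementary substructures of $\mathfrak C$; a model of $T^2$ is written $M_P=\langle M,P(M)\rangle$, and $P(A)=P(M)\cap A$ for $A\subseteq M$. For a complete type $q$ over $A\supseteq B$, $q\downarrow_B A$ means $c\downarrow_B A$ for a realization $c$ of $q$ in $\mathfrak C$. For a small cardinal $\kappa>\max(\kappa_0,|T|)$, a set is very small if its cardinality is $<\kappa$. $M_P\models T^2$ is a $\kappa$-lovely pair if: (1) $M$ is a small model of $T$; (2) (Density property) for every very small $A\subset M$ and $q\in S^1_1(A)$ with $q\downarrow_{P(A)}A$,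 $q$ is realized in $P(M)$; (3) (Extension property) for every very small $A\subset M$ and $q\in S^1_1(A)$ there is $b\in M$ realizing $q$ with $b\downarrow_A P(M)$.
   Formalization: The monstrosity of the monster model is assumed to be a strong limit cardinal; without some such largeness the claim fails (dense linear orders, trivial independence, κ = ℵ_ω, monstrosity ℵ_{ω+1}). *)

theory Defs
  imports Main
begin

unbundle cardinal_syntax

section \<open>First-order logic\<close>

text \<open>
  The symbols of a language form subsets of the symbol types, so that a language may lack
  function symbols or relation symbols altogether. Constants are function symbols of arity 0;
  equality is a logical symbol.
\<close>

record ('f, 'r) lang =
  funs :: "'f set"
  rels :: "'r set"
  far :: "'f \<Rightarrow> nat"
  rar :: "'r \<Rightarrow> nat"

datatype 'f trm = Var nat | Fn 'f "'f trm list"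

datatype ('f, 'r) fm =
    Eq "'f trm" "'f trm"
  | Rel 'r "'f trm list"
  | Neg "('f, 'r) fm"
  | Conj "('f, 'r) fm" "('f, 'r) fm"
  | Exi nat "('f, 'r) fm"

fun wf_trm :: "('f, 'r) lang \<Rightarrow> 'f trm \<Rightarrow> bool" where
  "wf_trm L (Var n) \<longleftrightarrow> True"
| "wf_trm L (Fn f ts) \<longleftrightarrow> f \<in> funs L \<and> length ts = far L f \<and> (\<forall>t\<in>set ts. wf_trm L t)"

fun wf_fm :: "('f, 'r) lang \<Rightarrow> ('f, 'r) fm \<Rightarrow> bool" where
  "wf_fm L (Eq s t) \<longleftrightarrow> wf_trm L s \<and> wf_trm L t"
| "wf_fm L (Rel r ts) \<longleftrightarrow> r \<in> rels L \<and> length ts = rar L r \<and> (\<forall>t\<in>set ts. wf_trm L t)"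
| "wf_fm L (Neg p) \<longleftrightarrow> wf_fm L p"
| "wf_fm L (Conj p q) \<longleftrightarrow> wf_fm L p \<and> wf_fm L q"
| "wf_fm L (Exi n p) \<longleftrightarrow> wf_fm L p"

fun fv_trm :: "'f trm \<Rightarrow> nat set" where
  "fv_trm (Var n) = {n}"
| "fv_trm (Fn f ts) = (\<Union>t\<in>set ts. fv_trm t)"

fun fv :: "('f, 'r) fm \<Rightarrow> nat set" where
  "fv (Eq s t) = fv_trm s \<union> fv_trm t"
| "fv (Rel r ts) = (\<Union>t\<in>set ts. fv_trm t)"
| "fv (Neg p) = fv p"
| "fv (Conj p q) = fv p \<union> fv q"
| "fv (Exi n p) = fv p - {n}"

definition sentences :: "('f, 'r) lang \<Rightarrow> ('f, 'r) fm set" where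
  "sentences L = {p. wf_fm L p \<and> fv p = {}}"

record ('f, 'r, 'a) struc =
  dom :: "'a set"
  fint :: "'f \<Rightarrow> 'a list \<Rightarrow> 'a"
  rint :: "'r \<Rightarrow> 'a list \<Rightarrow> bool"

definition is_struc :: "('f, 'r) lang \<Rightarrow> ('f, 'r, 'a) struc \<Rightarrow> bool" where
  "is_struc L N \<longleftrightarrow> dom N \<noteq> {} \<and>
     (\<forall>f\<in>funs L. \<forall>xs\<in>lists (dom N). length xs = far L f \<longrightarrow> fint N f xs \<in> dom N)"

fun val :: "('f, 'r, 'a) struc \<Rightarrow> (nat \<Rightarrow> 'a) \<Rightarrow> 'f trm \<Rightarrow> 'a" where
  "val N e (Var n) = e n"
| "val N e (Fn f ts) = fint N f (map (val N e) ts)"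

fun sat :: "('f, 'r, 'a) struc \<Rightarrow> (nat \<Rightarrow> 'a) \<Rightarrow> ('f, 'r) fm \<Rightarrow> bool" where
  "sat N e (Eq s t) \<longleftrightarrow> val N e s = val N e t"
| "sat N e (Rel r ts) \<longleftrightarrow> rint N r (map (val N e) ts)"
| "sat N e (Neg p) \<longleftrightarrow> \<not> sat N e p"
| "sat N e (Conj p q) \<longleftrightarrow> sat N e p \<and> sat N e q"
| "sat N e (Exi n p) \<longleftrightarrow> (\<exists>a\<in>dom N. sat N (e(n := a)) p)"

definition is_model :: "('f, 'r) lang \<Rightarrow> ('f, 'r) fm set \<Rightarrow> ('f, 'r, 'a) struc \<Rightarrow> bool" where
  "is_model L T N \<longleftrightarrow> is_struc L N \<and> (\<forall>p\<in>T. \<forall>e. range e \<subseteq> dom N \<longrightarrow> sat N e p)"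

text \<open>
  A complete theory is a set of sentences containing each sentence or its negation (its
  consistency is part of \<open>monster\<close> below, where it has a model). In particular it is closed
  under consequence, and its cardinality is that of the set of all sentences,
  i.e. \<open>|L| + \<aleph>\<^sub>0\<close>.
\<close>

definition complete_theory :: "('f, 'r) lang \<Rightarrow> ('f, 'r) fm set \<Rightarrow> bool" where
  "complete_theory L T \<longleftrightarrow> T \<subseteq> sentences L \<and> (\<forall>p\<in>sentences L. p \<in> T \<or> Neg p \<in> T)"

definition substruc ::
  "('f, 'r) lang \<Rightarrow> ('f, 'r, 'a) struc \<Rightarrow> ('f, 'r, 'a) struc \<Rightarrow> bool" where
  "substruc L N N' \<longleftrightarrow> is_struc L N \<and> is_struc L N' \<and> dom N \<subseteq> dom N' \<and>
     (\<forall>f\<in>funs L. \<forall>xs\<in>lists (dom N). length xs = far L f \<longrightarrow> fint N f xs = fint N' f xs) \<and>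
     (\<forall>r\<in>rels L. \<forall>xs\<in>lists (dom N). length xs = rar L r \<longrightarrow> rint N r xs = rint N' r xs)"

definition elem_substruc ::
  "('f, 'r) lang \<Rightarrow> ('f, 'r, 'a) struc \<Rightarrow> ('f, 'r, 'a) struc \<Rightarrow> bool" where
  "elem_substruc L N N' \<longleftrightarrow> substruc L N N' \<and>
     (\<forall>p e. wf_fm L p \<and> range e \<subseteq> dom N \<longrightarrow> sat N e p = sat N' e p)"

definition induced :: "('f, 'r, 'a) struc \<Rightarrow> 'a set \<Rightarrow> ('f, 'r, 'a) struc" where
  "induced N A = N\<lparr>dom := A\<rparr>"

definition automorphism ::
  "('f, 'r) lang \<Rightarrow> ('f, 'r, 'a) struc \<Rightarrow> ('a \<Rightarrow> 'a) \<Rightarrow> bool" where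
  "automorphism L N \<sigma> \<longleftrightarrow> bij_betw \<sigma> (dom N) (dom N) \<and>
     (\<forall>f\<in>funs L. \<forall>xs\<in>lists (dom N). length xs = far L f \<longrightarrow>
        \<sigma> (fint N f xs) = fint N f (map \<sigma> xs)) \<and>
     (\<forall>r\<in>rels L. \<forall>xs\<in>lists (dom N). length xs = rar L r \<longrightarrow>
        rint N r xs = rint N r (map \<sigma> xs))"

definition elem_map ::
  "('f, 'r) lang \<Rightarrow> ('f, 'r, 'a) struc \<Rightarrow> ('a \<Rightarrow> 'a) \<Rightarrow> 'a set \<Rightarrow> bool" where
  "elem_map L N g A \<longleftrightarrow> A \<subseteq> dom N \<and> g ` A \<subseteq> dom N \<and>
     (\<forall>p e. wf_fm L p \<and> range e \<subseteq> A \<longrightarrow> sat N e p = sat N (g \<circ> e) p)"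

text \<open>
  \<open>A' \<equiv>\<^sub>B A\<close>: for some enumeration of \<open>A\<close>, the set \<open>A'\<close> is enumerated by a tuple with the
  same type over \<open>B\<close>; the map \<open>g\<close> sends each entry to the corresponding one.
\<close>

definition equiv_over ::
  "('f, 'r) lang \<Rightarrow> ('f, 'r, 'a) struc \<Rightarrow> 'a set \<Rightarrow> 'a set \<Rightarrow> 'a set \<Rightarrow> bool" where
  "equiv_over L N B A' A \<longleftrightarrow>
     (\<exists>g. elem_map L N g (A \<union> B) \<and> (\<forall>b\<in>B. g b = b) \<and> g ` A = A')"

text \<open>The language \<open>L(A)\<close>, with a constant \<open>Inr a\<close> for each \<open>a \<in> A\<close>.\<close>

definition lang_params :: "('f, 'r) lang \<Rightarrow> 'a set \<Rightarrow> ('f + 'a, 'r) lang" where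
  "lang_params L A =
     \<lparr>funs = Inl ` funs L \<union> Inr ` A, rels = rels L,
      far = case_sum (far L) (\<lambda>_. 0), rar = rar L\<rparr>"

definition struc_params :: "('f, 'r, 'a) struc \<Rightarrow> ('f + 'a, 'r, 'a) struc" where
  "struc_params N = \<lparr>dom = dom N, fint = case_sum (fint N) (\<lambda>a _. a), rint = rint N\<rparr>"

definition fms1 :: "('f, 'r) lang \<Rightarrow> 'a set \<Rightarrow> ('f + 'a, 'r) fm set" where
  "fms1 L A = {p. wf_fm (lang_params L A) p \<and> fv p \<subseteq> {0}}"

definition realizes :: "('f, 'r, 'a) struc \<Rightarrow> 'a \<Rightarrow> ('f + 'a, 'r) fm set \<Rightarrow> bool" where
  "realizes N b q \<longleftrightarrow> (\<forall>p\<in>q. sat (struc_params N) (\<lambda>_. b) p)"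

definition types1 ::
  "('f, 'r) lang \<Rightarrow> ('f, 'r, 'a) struc \<Rightarrow> 'a set \<Rightarrow> ('f + 'a, 'r) fm set set" where
  "types1 L N A = {q. q \<subseteq> fms1 L A \<and> (\<forall>p\<in>fms1 L A. p \<in> q \<or> Neg p \<in> q) \<and>
     (\<forall>F. finite F \<and> F \<subseteq> q \<longrightarrow> (\<exists>b\<in>dom N. realizes N b F))}"


section \<open>Monster models\<close>

text \<open>
  Cardinals are cardinal well-orders. \<open>mon\<close> is the monstrosity of the monster model; a cardinal
  below it has a representative on the same type \<open>'m\<close>, which is why quantification over
  small cardinals is over relations on \<open>'m\<close>.
\<close>

definition small :: "'m rel \<Rightarrow> ('f, 'r, 'a) struc \<Rightarrow> 'a set \<Rightarrow> bool" where
  "small mon \<CC> A \<longleftrightarrow> A \<subseteq> dom \<CC> \<and> |A| <o mon"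

definition saturated ::
  "('f, 'r) lang \<Rightarrow> 'm rel \<Rightarrow> ('f, 'r, 'a) struc \<Rightarrow> bool" where
  "saturated L mon \<CC> \<longleftrightarrow>
     (\<forall>A q. small mon \<CC> A \<and> q \<in> types1 L \<CC> A \<longrightarrow> (\<exists>b\<in>dom \<CC>. realizes \<CC> b q))"

definition strongly_homogeneous ::
  "('f, 'r) lang \<Rightarrow> 'm rel \<Rightarrow> ('f, 'r, 'a) struc \<Rightarrow> bool" where
  "strongly_homogeneous L mon \<CC> \<longleftrightarrow>
     (\<forall>A g. small mon \<CC> A \<and> elem_map L \<CC> g A \<longrightarrow>
        (\<exists>\<sigma>. automorphism L \<CC> \<sigma> \<and> (\<forall>a\<in>A. \<sigma> a = g a)))"

text \<open>
  "Monster" implies that the monstrosity is large. As usual this means a strong limit cardinal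
  greater than \<open>|T|\<close>; some such convention is indispensable, since a \<open>\<kappa>\<close>-lovely pair realizes all
  types over its very small subsets, so that small ones need not exist if, for
  example, \<open>2^\<aleph>\<^sub>0\<close> is not small.
\<close>

definition strong_limit :: "'m rel \<Rightarrow> bool" where
  "strong_limit mon \<longleftrightarrow> Card_order mon \<and> cinfinite mon \<and>
     (\<forall>X :: 'm set. |X| <o mon \<longrightarrow> |Pow X| <o mon)"

definition monster ::
  "('f, 'r) lang \<Rightarrow> ('f, 'r) fm set \<Rightarrow> 'm rel \<Rightarrow> ('f, 'r, 'a) struc \<Rightarrow> bool" where
  "monster L T mon \<CC> \<longleftrightarrow> is_model L T \<CC> \<and> strong_limit mon \<and> |T| <o mon \<and>
     saturated L mon \<CC> \<and> strongly_homogeneous L mon \<CC>"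


section \<open>Independence relations\<close>

text \<open>\<open>I A B C\<close> is to be read as \<open>A \<down>\<^sub>B C\<close>: the base is the middle argument. Its values on
  sets that are not small are irrelevant.\<close>

definition independence ::
  "('f, 'r) lang \<Rightarrow> 'm rel \<Rightarrow> ('f, 'r, 'a) struc \<Rightarrow>
   ('a set \<Rightarrow> 'a set \<Rightarrow> 'a set \<Rightarrow> bool) \<Rightarrow> bool" where
  "independence L mon \<CC> I \<longleftrightarrow>
     \<comment> \<open>invariance\<close>
     (\<forall>A B C \<sigma>. small mon \<CC> A \<and> small mon \<CC> B \<and> small mon \<CC> C \<and> automorphism L \<CC> \<sigma> \<and> I A B C
        \<longrightarrow> I (\<sigma> ` A) (\<sigma> ` B) (\<sigma> ` C)) \<and>
     \<comment> \<open>normality\<close>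
     (\<forall>A B C. small mon \<CC> A \<and> small mon \<CC> B \<and> small mon \<CC> C \<and> I A C B \<longrightarrow> I (A \<union> C) C B) \<and>
     \<comment> \<open>symmetry\<close>
     (\<forall>A B C. small mon \<CC> A \<and> small mon \<CC> B \<and> small mon \<CC> C \<and> I A B C \<longrightarrow> I C B A) \<and>
     \<comment> \<open>transitivity\<close>
     (\<forall>A B C D. small mon \<CC> A \<and> small mon \<CC> B \<and> small mon \<CC> C \<and> small mon \<CC> D \<and>
        B \<subseteq> C \<and> C \<subseteq> D \<longrightarrow> (I A B D \<longleftrightarrow> I A B C \<and> I A C D)) \<and>
     \<comment> \<open>finite character\<close>
     (\<forall>A B C. small mon \<CC> A \<and> small mon \<CC> B \<and> small mon \<CC> C \<longrightarrow>
        (I A B C \<longleftrightarrow> (\<forall>A0. finite A0 \<and> A0 \<subseteq> A \<longrightarrow> I A0 B C))) \<and>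
     \<comment> \<open>extension\<close>
     (\<forall>A B C. small mon \<CC> A \<and> small mon \<CC> B \<and> small mon \<CC> C \<longrightarrow>
        (\<exists>A'. equiv_over L \<CC> B A' A \<and> I A' B C)) \<and>
     \<comment> \<open>local character\<close>
     (\<exists>\<mu> :: 'm rel. Card_order \<mu> \<and> \<mu> <o mon \<and>
        (\<forall>A C. small mon \<CC> A \<and> small mon \<CC> C \<longrightarrow>
           (\<exists>C0. C0 \<subseteq> C \<and> |C0| <o \<mu> +c cardSuc |A| \<and> I A C0 C)))"

text \<open>The extension of \<open>\<down>\<close> to arbitrary subsets of the monster model.\<close>

definition indep_ext ::
  "'m rel \<Rightarrow> ('f, 'r, 'a) struc \<Rightarrow> ('a set \<Rightarrow> 'a set \<Rightarrow> 'a set \<Rightarrow> bool) \<Rightarrow>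
   'a set \<Rightarrow> 'a set \<Rightarrow> 'a set \<Rightarrow> bool" where
  "indep_ext mon \<CC> I A B C \<longleftrightarrow>
     (\<forall>A' B' C'. small mon \<CC> A' \<and> A' \<subseteq> A \<and> small mon \<CC> B' \<and> B' \<subseteq> B \<and> small mon \<CC> C' \<and> C' \<subseteq> C
        \<longrightarrow> (\<exists>B''. small mon \<CC> B'' \<and> B' \<subseteq> B'' \<and> B'' \<subseteq> B \<and> I A' B'' C'))"

lemma small_subset: "small mon \<CC> A \<Longrightarrow> B \<subseteq> A \<Longrightarrow> small mon \<CC> B"
  unfolding small_def by (meson card_of_mono1 ordLeq_ordLess_trans subset_trans)

text \<open>On small sets the extension is the original relation.\<close>

lemma indep_ext_iff:
  assumes I: "independence L mon \<CC> I"
    and A: "small mon \<CC> A" and B: "small mon \<CC> B" and C: "small mon \<CC> C"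
  shows "indep_ext mon \<CC> I A B C \<longleftrightarrow> I A B C"
proof
  assume "indep_ext mon \<CC> I A B C"
  from this[unfolded indep_ext_def, rule_format, of A B C] A B C
  obtain B'' where "B \<subseteq> B''" "B'' \<subseteq> B" "I A B'' C" by auto
  then show "I A B C" by simp
next
  have "\<forall>A B C. small mon \<CC> A \<and> small mon \<CC> B \<and> small mon \<CC> C \<and> I A B C \<longrightarrow> I C B A"
    using I unfolding independence_def by (elim conjE)
  then have sym: "I Z Y X"
    if "small mon \<CC> X" "small mon \<CC> Y" "small mon \<CC> Z" "I X Y Z" for X Y Z
    using that by simp
  have "\<forall>A B C. small mon \<CC> A \<and> small mon \<CC> B \<and> small mon \<CC> C \<longrightarrow>
      (I A B C \<longleftrightarrow> (\<forall>A0. finite A0 \<and> A0 \<subseteq> A \<longrightarrow> I A0 B C))"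
    using I unfolding independence_def by (elim conjE)
  then have fc: "I X Y Z \<longleftrightarrow> (\<forall>X0. finite X0 \<and> X0 \<subseteq> X \<longrightarrow> I X0 Y Z)"
    if "small mon \<CC> X" "small mon \<CC> Y" "small mon \<CC> Z" for X Y Z
    using that by simp
  have mono: "I X' Y Z" if h: "small mon \<CC> X" "small mon \<CC> Y" "small mon \<CC> Z"
    and sub: "X' \<subseteq> X" and XYZ: "I X Y Z" for X X' Y Z
  proof -
    have "\<forall>X0. finite X0 \<and> X0 \<subseteq> X' \<longrightarrow> I X0 Y Z"
      using XYZ sub unfolding fc[OF h] by (metis subset_trans)
    then show ?thesis using fc[OF small_subset[OF h(1) sub] h(2,3)] by simp
  qed
  assume *: "I A B C"
  show "indep_ext mon \<CC> I A B C"
    unfolding indep_ext_def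
  proof (intro allI impI)
    fix A' B' C'
    assume h: "small mon \<CC> A' \<and> A' \<subseteq> A \<and> small mon \<CC> B' \<and> B' \<subseteq> B \<and> small mon \<CC> C' \<and> C' \<subseteq> C"
    then have A': "small mon \<CC> A'" "A' \<subseteq> A" and C': "small mon \<CC> C'" "C' \<subseteq> C" and B': "B' \<subseteq> B"
      by simp_all
    have "I A' B C" by (rule mono[OF A B C A'(2) *])
    then have "I C B A'" by (rule sym[OF A'(1) B C])
    then have "I C' B A'" by (rule mono[OF C B A'(1) C'(2)])
    then have "I A' B C'" by (rule sym[OF C'(1) B A'(1)])
    then show "\<exists>B''. small mon \<CC> B'' \<and> B' \<subseteq> B'' \<and> B'' \<subseteq> B \<and> I A' B'' C'"
      using B B' by (intro exI[of _ B]) simp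
  qed
qed

definition cl ::
  "'m rel \<Rightarrow> ('f, 'r, 'a) struc \<Rightarrow> ('a set \<Rightarrow> 'a set \<Rightarrow> 'a set \<Rightarrow> bool) \<Rightarrow> 'a set \<Rightarrow> 'a set" where
  "cl mon \<CC> I A = {c \<in> dom \<CC>. indep_ext mon \<CC> I {c} A {c}}"

text \<open>
  \<open>\<mu>\<close> is \<open>\<kappa>\<^sub>0\<close>. Regular cardinals are infinite. If \<open>\<nu>\<^sub>0\<close> is the cardinal in local character, then
  \<open>(\<nu>\<^sub>0 + \<aleph>\<^sub>0)\<^sup>+\<close> is a small regular cardinal with the defining property, so \<open>\<kappa>\<^sub>0\<close> exists and minimality
  has to be tested against cardinals on \<open>'m\<close> only.
\<close>

definition kappa0_property ::
  "'m rel \<Rightarrow> ('f, 'r, 'a) struc \<Rightarrow> ('a set \<Rightarrow> 'a set \<Rightarrow> 'a set \<Rightarrow> bool) \<Rightarrow> 'm rel \<Rightarrow> bool" where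
  "kappa0_property mon \<CC> I \<mu> \<longleftrightarrow> Card_order \<mu> \<and> cinfinite \<mu> \<and> regularCard \<mu> \<and>
     (\<forall>A B. finite A \<and> A \<subseteq> dom \<CC> \<and> small mon \<CC> B \<longrightarrow>
        (\<exists>B0. B0 \<subseteq> B \<and> |B0| <o \<mu> \<and> I A B0 B))"

definition is_kappa0 ::
  "'m rel \<Rightarrow> ('f, 'r, 'a) struc \<Rightarrow> ('a set \<Rightarrow> 'a set \<Rightarrow> 'a set \<Rightarrow> bool) \<Rightarrow> 'm rel \<Rightarrow> bool" where
  "is_kappa0 mon \<CC> I \<mu> \<longleftrightarrow> kappa0_property mon \<CC> I \<mu> \<and>
     (\<forall>\<nu>. kappa0_property mon \<CC> I \<nu> \<longrightarrow> \<mu> \<le>o \<nu>)"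


section \<open>Lovely pairs\<close>

text \<open>\<open>L\<^sup>2\<close>, with \<open>None\<close> as the new unary predicate \<open>P\<close>.\<close>

definition lang2 :: "('f, 'r) lang \<Rightarrow> ('f, 'r option) lang" where
  "lang2 L = \<lparr>funs = funs L, rels = insert None (Some ` rels L),
     far = far L, rar = case_option 1 (rar L)\<rparr>"

definition reduct :: "('f, 'r option, 'a) struc \<Rightarrow> ('f, 'r, 'a) struc" where
  "reduct N = \<lparr>dom = dom N, fint = fint N, rint = (\<lambda>r. rint N (Some r))\<rparr>"

text \<open>
  The theory of all expansions to \<open>L\<^sup>2\<close> of models of \<open>T\<close>. Considering only structures on \<open>'a\<close> is no
  restriction when \<open>'a\<close> is the type of a monster model: by Loewenheim-Skolem, an \<open>L\<^sup>2\<close>-sentence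
  false in some expansion of a model of \<open>T\<close> is false in one that is finite or of cardinality at
  most \<open>|T|\<close>.
\<close>

definition theory2 ::
  "('f, 'r) lang \<Rightarrow> ('f, 'r) fm set \<Rightarrow> 'a itself \<Rightarrow> ('f, 'r option) fm set" where
  "theory2 L T _ = {p \<in> sentences (lang2 L).
     \<forall>N :: ('f, 'r option, 'a) struc. is_struc (lang2 L) N \<and> is_model L T (reduct N) \<longrightarrow>
       (\<forall>e. range e \<subseteq> dom N \<longrightarrow> sat N e p)}"

text \<open>The structure \<open>\<langle>M, P\<rangle>\<close>, with the \<open>L\<close>-structure on \<open>M\<close> induced from \<open>\<CC>\<close>.\<close>

definition pair_struc ::
  "('f, 'r, 'a) struc \<Rightarrow> 'a set \<Rightarrow> 'a set \<Rightarrow> ('f, 'r option, 'a) struc" where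
  "pair_struc \<CC> M P = \<lparr>dom = M, fint = fint \<CC>,
     rint = (\<lambda>r xs. case r of None \<Rightarrow> xs \<in> (\<lambda>x. [x]) ` P | Some r' \<Rightarrow> rint \<CC> r' xs)\<rparr>"

definition type_indep ::
  "('f, 'r, 'a) struc \<Rightarrow> ('a set \<Rightarrow> 'a set \<Rightarrow> 'a set \<Rightarrow> bool) \<Rightarrow>
   ('f + 'a, 'r) fm set \<Rightarrow> 'a set \<Rightarrow> 'a set \<Rightarrow> bool" where
  "type_indep \<CC> I q B A \<longleftrightarrow> (\<exists>c\<in>dom \<CC>. realizes \<CC> c q \<and> I {c} B A)"

text \<open>Since \<open>M\<close> is an elementary substructure of \<open>\<CC>\<close>, types over subsets of \<open>M\<close>, and their
  realizations in \<open>M\<close>, may be computed in \<open>\<CC>\<close>.\<close>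

definition lovely_pair ::
  "('f, 'r) lang \<Rightarrow> ('f, 'r) fm set \<Rightarrow> 'm rel \<Rightarrow> ('f, 'r, 'a) struc \<Rightarrow>
   ('a set \<Rightarrow> 'a set \<Rightarrow> 'a set \<Rightarrow> bool) \<Rightarrow> 'k rel \<Rightarrow> 'a set \<Rightarrow> 'a set \<Rightarrow> bool" where
  "lovely_pair L T mon \<CC> I \<kappa> M P \<longleftrightarrow>
     P \<subseteq> M \<and> is_model (lang2 L) (theory2 L T TYPE('a)) (pair_struc \<CC> M P) \<and>
     small mon \<CC> M \<and> elem_substruc L (induced \<CC> M) \<CC> \<and>
     (\<forall>A q. A \<subseteq> M \<and> |A| <o \<kappa> \<and> q \<in> types1 L \<CC> A \<and> type_indep \<CC> I q (P \<inter> A) A \<longrightarrow>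
        (\<exists>b\<in>P. realizes \<CC> b q)) \<and>
     (\<forall>A q. A \<subseteq> M \<and> |A| <o \<kappa> \<and> q \<in> types1 L \<CC> A \<longrightarrow>
        (\<exists>b\<in>M. realizes \<CC> b q \<and> I {b} A P))"

end

theory Submission
  imports Defs
begin

text \<open>
  The pair is built from \<open>\<langle>C, P(C)\<rangle>\<close> by adding single elements along a well-order of steps. Every step
  has a task: a very small set \<open>A\<close> in the universe so far and a type \<open>q\<close> over \<open>A\<close>, to be realized
  for the density property or for the extension property. By extension \<open>q\<close> has a realization \<open>b\<close>
  that is free over \<open>A\<close> from the whole universe \<open>S\<close> so far, and \<open>b\<close> is added. With \<open>P\<close> the predicate
  so far, \<open>b\<close> enters the predicate if \<open>b\<close> is in \<open>cl(P)\<close>, or if the task is one of density and \<open>b\<close> is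
  free from \<open>S\<close> over \<open>P\<close>. In either case \<open>b\<close> is free from \<open>S\<close> over \<open>P\<close>.

  Hence, by induction and finite character, the predicate of any later stage is free over the
  predicate of an earlier stage from the universe of that stage (\<open>free_over\<close>); for the first
  stage this is the independence of \<open>P(M)\<close> and \<open>C\<close> over \<open>P(C)\<close>. Since elements of \<open>cl(P)\<close> always enter
  the predicate, the predicate stays closed in the universe (\<open>closed_mem\<close>), and so never grows
  inside the universe of an earlier stage (\<open>trace\<close>). It follows that a type \<open>q\<close> over \<open>A\<close> which is free over
  \<open>P(A)\<close> gets its realization in the predicate (\<open>density\<close>), and that a realization added for the
  extension property remains free over \<open>A\<close> from the final predicate (\<open>extension\<close>). As the extension
  property yields realizations of all types over finite subsets, the universe is an elementary
  substructure (\<open>elementary_if_conjugates\<close>).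

  Since the monstrosity may be singular, the size of the universe must be bounded in advance.
  With \<open>W\<close> of cardinality \<open>|C| + \<kappa>\<close> and \<open>\<Lambda> = Pow (Pow W)\<close>, a set of size at most \<open>|\<Lambda>|\<close> has at most
  \<open>|\<Lambda>|\<close> very small subsets, each with at most \<open>|\<Lambda>|\<close> types over it (\<open>exists_task_list\<close>). Therefore
  \<open>\<kappa>\<^sup>+\<close> stages, each carrying out in \<open>|\<Lambda>|\<close> steps all tasks present at its beginning, suffice, and
  the result has size at most \<open>|\<Lambda>|\<close>, which is small because the monstrosity is a strong limit.
\<close>

section \<open>Calculus of independence\<close>

text \<open>
  The formal rules for subsets of one fixed set \<open>U\<close>, which in the application is small.
  \<open>I A B C\<close> says that \<open>A\<close> is free from \<open>C\<close> over the middle argument \<open>B\<close>. The rule \<open>self\<close>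
  is what remains of extension.
\<close>

locale indep_calculus =
  fixes U :: "'a set" and I :: "'a set \<Rightarrow> 'a set \<Rightarrow> 'a set \<Rightarrow> bool"
  assumes norm: "A \<subseteq> U \<Longrightarrow> B \<subseteq> U \<Longrightarrow> C \<subseteq> U \<Longrightarrow> I A C B \<Longrightarrow> I (A \<union> C) C B"
    and sym: "A \<subseteq> U \<Longrightarrow> B \<subseteq> U \<Longrightarrow> C \<subseteq> U \<Longrightarrow> I A B C \<Longrightarrow> I C B A"
    and trans: "A \<subseteq> U \<Longrightarrow> D \<subseteq> U \<Longrightarrow> B \<subseteq> C \<Longrightarrow> C \<subseteq> D \<Longrightarrow> I A B D \<longleftrightarrow> I A B C \<and> I A C D"
    and fin: "A \<subseteq> U \<Longrightarrow> B \<subseteq> U \<Longrightarrow> C \<subseteq> U \<Longrightarrow>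
      I A B C \<longleftrightarrow> (\<forall>A0. finite A0 \<and> A0 \<subseteq> A \<longrightarrow> I A0 B C)"
    and self: "A \<subseteq> U \<Longrightarrow> B \<subseteq> U \<Longrightarrow> I A B B"
begin

lemma mono_left:
  assumes "A \<subseteq> U" "B \<subseteq> U" "C \<subseteq> U" "I A B C" "A' \<subseteq> A"
  shows "I A' B C"
  using fin[of A B C] fin[of A' B C] assms by (meson subset_trans)

lemma mono_right:
  assumes "A \<subseteq> U" "B \<subseteq> U" "C \<subseteq> U" "I A B C" "C' \<subseteq> C"
  shows "I A B C'"
  using sym[of C' B A] mono_left[of C B A C'] sym[of A B C] assms by (meson subset_trans)

lemma absorb:
  assumes "A \<subseteq> U" "B \<subseteq> U" "C \<subseteq> U" "I A B C"
  shows "I A B (B \<union> C)"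
  using norm[of C A B] sym[of A B C] sym[of "C \<union> B" B A] assms by (simp add: Un_commute)

lemma base_mono:
  assumes "A \<subseteq> U" "B \<subseteq> U" "D \<subseteq> U" "I A B D" "C \<subseteq> D"
  shows "I A (B \<union> C) D"
proof -
  have "I A B (B \<union> D)" by (rule absorb) fact+
  then have "I A (B \<union> C) (B \<union> D)" using trans[of A "B \<union> D" B "B \<union> C"] assms by blast
  then show ?thesis using mono_right[of A "B \<union> C" "B \<union> D" D] assms by blast
qed

lemma chain:
  assumes "A \<subseteq> U" "B \<subseteq> U" "C \<subseteq> U" "D \<subseteq> U" "I A B C" "I A (B \<union> C) D"
  shows "I A B (C \<union> D)"
proof -
  have "I A B (B \<union> C)" "I A (B \<union> C) (B \<union> C \<union> D)"
    using absorb[of A B C] absorb[of A "B \<union> C" D] assms by auto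
  then have "I A B (B \<union> C \<union> D)"
    using trans[of A "B \<union> C \<union> D" B "B \<union> C"] assms by blast
  then show ?thesis using mono_right[of A B "B \<union> C \<union> D" "C \<union> D"] assms by blast
qed

text \<open>An element of the closure of \<open>B\<close> is free over \<open>B\<close> from everything.\<close>

lemma indep_self_imp:
  assumes "A \<subseteq> U" "B \<subseteq> U" "D \<subseteq> U" "I A B A"
  shows "I A B D"
proof -
  have "I D (B \<union> A) (B \<union> A)" using self assms by simp
  then have "I (B \<union> A) (B \<union> A) D" using sym assms by simp
  then have "I A (B \<union> A) D" using mono_left[of "B \<union> A" "B \<union> A" D A] assms by simp
  then have "I A B (A \<union> D)" using chain assms by simp
  then show ?thesis using mono_right[of A B "A \<union> D" D] assms by simp
qed

end

section \<open>Sequences of free choices\<close>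

lemma finite_has_last:
  assumes "finite N" "N \<noteq> {}" "trans R"
    and "\<And>j k. j \<in> N \<Longrightarrow> k \<in> N \<Longrightarrow> j \<noteq> k \<Longrightarrow> (j, k) \<in> R \<or> (k, j) \<in> R"
  shows "\<exists>j\<in>N. \<forall>k\<in>N. k = j \<or> (k, j) \<in> R"
  using assms(1,2,4)
proof (induction rule: finite_ne_induct)
  case (insert x F)
  then obtain j where j: "j \<in> F" "\<forall>k\<in>F. k = j \<or> (k, j) \<in> R" by blast
  have "(j, x) \<in> R \<or> (x, j) \<in> R" using insert.prems[of j x] insert.hyps j by blast
  then show ?case
  proof
    assume "(j, x) \<in> R"
    then show ?thesis using j \<open>trans R\<close> by (metis insert_iff transD)
  qed (use j in blast)
qed simp

text \<open>
  A sequence \<open>b\<close> of elements indexed by a well-ordered set \<open>J\<close> is added to \<open>\<langle>C, PC\<rangle>\<close>, and \<open>p j\<close> tells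
  whether \<open>b j\<close> is put into the predicate. \<open>S D\<close> and \<open>P D\<close> are the universe and the predicate
  generated by the indices in \<open>D\<close>. An element is put into the predicate only if it is free from
  the preceding universe over the preceding predicate, and has to be put there if it lies in the
  closure of the preceding predicate.
\<close>

locale free_sequence = indep_calculus U I
  for U :: "'a set" and I +
  fixes R :: "'j rel" and J :: "'j set" and C PC :: "'a set" and b :: "'j \<Rightarrow> 'a"
    and p :: "'j \<Rightarrow> bool" and below :: "'j \<Rightarrow> 'j set" and S P :: "'j set \<Rightarrow> 'a set"
  assumes below_def: "below j = {k. (k, j) \<in> R}"
    and S_def: "S D = C \<union> b ` D"
    and P_def: "P D = PC \<union> b ` {j \<in> D. p j}"
    and wf: "wf R" and R_sub: "R \<subseteq> J \<times> J" and trans_R: "trans R"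
    and total: "j \<in> J \<Longrightarrow> k \<in> J \<Longrightarrow> j \<noteq> k \<Longrightarrow> (j, k) \<in> R \<or> (k, j) \<in> R"
    and C_sub: "C \<subseteq> U" and PC_sub: "PC \<subseteq> C" and b_in: "b ` J \<subseteq> U"
    and PC_closed: "x \<in> C \<Longrightarrow> I {x} PC {x} \<Longrightarrow> x \<in> PC"
    and flagged_free: "j \<in> J \<Longrightarrow> p j \<Longrightarrow> I {b j} (P (below j)) (S (below j))"
    and closed_flagged: "j \<in> J \<Longrightarrow> I {b j} (P (below j)) {b j} \<Longrightarrow> p j"
begin

text \<open>An initial segment of the index set.\<close>

definition initial :: "'j set \<Rightarrow> bool" where
  "initial D \<longleftrightarrow> D \<subseteq> J \<and> (\<forall>j\<in>D. below j \<subseteq> D)"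

lemma S_sub: "D \<subseteq> J \<Longrightarrow> S D \<subseteq> U"
  using C_sub b_in unfolding S_def by blast

lemma P_sub_S: "P D \<subseteq> S D"
  using PC_sub unfolding S_def P_def by blast

lemma P_sub: "D \<subseteq> J \<Longrightarrow> P D \<subseteq> U"
  using S_sub P_sub_S by blast

lemma P_mono: "D \<subseteq> D' \<Longrightarrow> P D \<subseteq> P D'"
  unfolding P_def by blast

lemma S_mono: "D \<subseteq> D' \<Longrightarrow> S D \<subseteq> S D'"
  unfolding S_def by blast

lemma below_sub: "below j \<subseteq> J"
  using R_sub unfolding below_def by blast

lemma initial_empty: "initial {}"
  unfolding initial_def by blast

lemma initial_below: "initial (below j)"
  using below_sub trans_R unfolding initial_def below_def by (blast dest: transD)

lemma initial_insert_below: "j \<in> J \<Longrightarrow> initial (insert j (below j))"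
  using initial_below[of j] unfolding initial_def by blast

lemma initial_sub_below:
  assumes "initial D" "j \<in> J" "j \<notin> D"
  shows "D \<subseteq> below j"
  using assms total unfolding initial_def below_def by blast

text \<open>
  By finite character only finitely many elements of \<open>P D'\<close> matter. The last of them is free from
  everything before it over the predicate before it, so it suffices to know the claim
  for the predicate before it.
\<close>

lemma free_over_step:
  assumes D: "initial D" and D': "D' \<subseteq> J" "D \<subseteq> D'"
    and step: "\<And>j. j \<in> D' - D \<Longrightarrow> I (P (below j)) (P D) (S D)"
  shows "I (P D') (P D) (S D)"
proof -
  have DJ: "D \<subseteq> J" using D unfolding initial_def by blast
  note U = S_sub[OF DJ] P_sub[OF DJ] P_sub[OF D'(1)]
  have "I X (P D) (S D)" if X: "finite X" "X \<subseteq> P D'" for X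
  proof -
    have "X - P D \<subseteq> b ` {j \<in> D' - D. p j}"
      using X(2) unfolding P_def by blast
    then obtain N where N: "finite N" "N \<subseteq> {j \<in> D' - D. p j}" "X - P D = b ` N"
      using X(1) by (meson finite_Diff finite_subset_image)
    show ?thesis
    proof (cases "N = {}")
      case True
      have "I (S D) (P D) (P D)" using self U by blast
      then have "I (P D) (P D) (S D)" using sym U by blast
      then show ?thesis using mono_left[of "P D" "P D" "S D" X] U N True by blast
    next
      case False
      then obtain j where j: "j \<in> N" "\<And>k. k \<in> N \<Longrightarrow> k = j \<or> k \<in> below j"
        using finite_has_last[OF N(1) False trans_R] total N(2) D' unfolding below_def by blast
      then have jD: "j \<in> D' - D" "p j" "j \<in> J" using N D' by blast+
      have Db: "D \<subseteq> below j" using initial_sub_below[OF D] jD by blast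
      have Ub: "P (below j) \<subseteq> U" "S (below j) \<subseteq> U" "{b j} \<subseteq> U"
        using P_sub[OF below_sub] S_sub[OF below_sub] b_in jD by auto
      have "I (S (below j)) (P (below j)) {b j}"
        using flagged_free[OF jD(3,2)] sym Ub by blast
      then have "I (S D) (P D \<union> P (below j)) {b j}"
        using mono_left[of "S (below j)" "P (below j)" "{b j}" "S D"] Ub S_mono[OF Db] P_mono[OF Db]
        by (simp add: Un_absorb1)
      moreover have "I (S D) (P D) (P (below j))"
        using step[OF jD(1)] sym U Ub by blast
      ultimately have "I (S D) (P D) (P (below j) \<union> {b j})"
        using chain[of "S D" "P D" "P (below j)" "{b j}"] U Ub by blast
      then have *: "I (P (below j) \<union> {b j}) (P D) (S D)"
        using sym[of "S D" "P D" "P (below j) \<union> {b j}"] U Ub by simp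
      have "b ` N \<subseteq> P (below j) \<union> {b j}"
        using j(2) N(2) unfolding P_def by blast
      then have "X \<subseteq> P (below j) \<union> {b j}"
        using N(3) P_mono[OF Db] by blast
      then show ?thesis
        using mono_left[of "P (below j) \<union> {b j}" "P D" "S D" X] * U Ub by blast
    qed
  qed
  then show ?thesis using fin[of "P D'" "P D" "S D"] U by blast
qed

text \<open>
  The main invariant: the predicate of a later stage is free from the universe of an earlier
  stage over the predicate of that earlier stage.
\<close>

lemma free_over:
  assumes D: "initial D" and D': "D' \<subseteq> J" "D \<subseteq> D'"
  shows "I (P D') (P D) (S D)"
proof -
  have "j \<in> J - D \<longrightarrow> I (P (below j)) (P D) (S D)" for j
    using wf
  proof (induction j)
    case (less j)
    show ?case
    proof
      assume j: "j \<in> J - D"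
      show "I (P (below j)) (P D) (S D)"
      proof (rule free_over_step[OF D below_sub])
        show "D \<subseteq> below j" using initial_sub_below[OF D] j by blast
        show "I (P (below k)) (P D) (S D)" if "k \<in> below j - D" for k
          using less[of k] that below_sub unfolding below_def by blast
      qed
    qed
  qed
  then show ?thesis using free_over_step[OF D D'] D' by blast
qed

lemma free_over_mem:
  assumes "initial D" "D' \<subseteq> J" "D \<subseteq> D'" "x \<in> S D"
  shows "I {x} (P D) (P D')"
proof -
  have "D \<subseteq> J" using assms by blast
  then show ?thesis
    using sym[OF _ _ _ free_over[OF assms(1-3)]] mono_left[of "S D" "P D" "P D'" "{x}"]
      P_sub S_sub assms by blast
qed

lemma closed_descend:
  assumes "initial D" "D' \<subseteq> J" "D \<subseteq> D'" "x \<in> S D" "I {x} (P D') {x}"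
  shows "I {x} (P D) {x}"
proof -
  have "D \<subseteq> J" using assms by blast
  then have U: "P D \<subseteq> U" "P D' \<subseteq> U" "{x} \<subseteq> U" using P_sub S_sub assms by blast+
  have "I {x} (P D) (P D' \<union> {x})"
    using chain[OF U(3,1,2,3) free_over_mem[OF assms(1-4)]] assms(5) P_mono[OF assms(3)]
    by (simp add: Un_absorb1)
  then show ?thesis using mono_right[of "{x}" "P D" "P D' \<union> {x}" "{x}"] U by blast
qed

text \<open>
  The predicate is closed in the universe at every stage. If \<open>b j\<close> lies in the closure of a later
  predicate, it lies in the closure of the predicate right after step \<open>j\<close>. Were \<open>b j\<close> not put into
  the predicate, this would be the predicate right before step \<open>j\<close>, so \<open>b j\<close> had to be put there.
  For elements of \<open>C\<close> the closedness of \<open>PC\<close> in \<open>C\<close> applies.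
\<close>

lemma closed_mem:
  assumes D: "initial D" and x: "x \<in> S D" "I {x} (P D) {x}"
  shows "x \<in> P D"
proof -
  have DJ: "D \<subseteq> J" using D unfolding initial_def by blast
  show ?thesis
  proof (cases "x \<in> C")
    case True
    then have "I {x} (P {}) {x}"
      using closed_descend[OF initial_empty DJ _ _ x(2)] unfolding S_def by blast
    then show ?thesis using PC_closed[OF True] unfolding P_def by simp
  next
    case False
    then obtain j where j: "j \<in> D" "x = b j" using x unfolding S_def by blast
    show ?thesis
    proof (rule ccontr)
      assume n: "x \<notin> P D"
      then have np: "\<not> p j" using j unfolding P_def by blast
      have "insert j (below j) \<subseteq> D" using j D unfolding initial_def by blast
      then have "I {x} (P (insert j (below j))) {x}"
        using closed_descend[OF initial_insert_below DJ _ _ x(2)] j DJ unfolding S_def by blast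
      moreover have "P (insert j (below j)) = P (below j)"
        using np unfolding P_def by blast
      ultimately show False using closed_flagged[of j] np j DJ by auto
    qed
  qed
qed

text \<open>No element of the universe of a stage enters the predicate later.\<close>

lemma trace:
  assumes D: "initial D"
  shows "P J \<inter> S D = P D"
proof
  have DJ: "D \<subseteq> J" using D unfolding initial_def by blast
  show "P D \<subseteq> P J \<inter> S D" using P_mono[OF DJ] P_sub_S by blast
  show "P J \<inter> S D \<subseteq> P D"
  proof
    fix x assume x: "x \<in> P J \<inter> S D"
    then have "I {x} (P D) {x}"
      using mono_right[OF _ _ _ free_over_mem[OF D order_refl DJ], of x "{x}"]
        P_sub S_sub DJ by blast
    then show "x \<in> P D" using closed_mem[OF D] x by blast
  qed
qed

text \<open>
  A free realization of a type over \<open>A\<close> that is free from \<open>A\<close> over the part of the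
  predicate in \<open>A\<close> qualifies for the predicate.
\<close>

lemma density:
  assumes j: "j \<in> J" and D: "initial D" "D \<subseteq> below j" and A: "A \<subseteq> S D"
    and free: "I {b j} A (S (below j))" "I {b j} (P J \<inter> A) A"
  shows "I {b j} (P (below j)) (S (below j))"
proof -
  have U: "{b j} \<subseteq> U" "S (below j) \<subseteq> U" "A \<subseteq> S (below j)"
    using b_in j S_sub[OF below_sub] A S_mono[OF D(2)] by blast+
  have PA: "P J \<inter> A \<subseteq> P (below j)"
    using trace[OF D(1)] A P_mono[OF D(2)] by blast
  have "I {b j} (P J \<inter> A) (A \<union> S (below j))"
    by (rule chain) (use U free in \<open>auto simp: Int_absorb1 Un_absorb1\<close>)
  then have "I {b j} (P J \<inter> A) (S (below j))"
    using U(3) by (simp add: Un_absorb1)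
  then have "I {b j} (P J \<inter> A \<union> P (below j)) (S (below j))"
    using base_mono[of "{b j}" "P J \<inter> A" "S (below j)" "P (below j)"] U P_sub_S by blast
  then show ?thesis using PA by (simp add: Un_absorb1)
qed

text \<open>
  An element chosen free over \<open>A\<close> from all before it, and put into the predicate only when that is
  unavoidable, stays free over \<open>A\<close> from the predicate of the whole.
\<close>

lemma extension:
  assumes j: "j \<in> J" and A: "A \<subseteq> S (below j)"
    and free: "I {b j} A (S (below j))"
    and flag: "p j \<Longrightarrow> I {b j} (P (below j)) {b j}"
  shows "I {b j} A (P J)"
proof -
  let ?B = "below j" and ?E = "insert j (below j)"
  have EJ: "?E \<subseteq> J" using j below_sub by blast
  have U: "{b j} \<subseteq> U" "S ?B \<subseteq> U" "P ?B \<subseteq> U" "P J \<subseteq> U" "S ?E \<subseteq> U" "P ?E \<subseteq> U"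
    using b_in j S_sub[OF below_sub] P_sub[OF below_sub] P_sub[OF order_refl]
      S_sub[OF EJ] P_sub[OF EJ] by (simp_all add: image_subset_iff)
  have UA: "A \<subseteq> U" using A U(2) by (rule subset_trans)
  note U = U UA
  have free': "I {b j} A (A \<union> P ?B)"
    using mono_right[of "{b j}" A "S ?B" "A \<union> P ?B"] free U A P_sub_S[of ?B] by simp
  show ?thesis
  proof (cases "p j")
    case True
    \<comment> \<open>Here \<open>b j\<close> is in the closure of \<open>A\<close> itself, hence free over \<open>A\<close> from everything.\<close>
    have "I {b j} (P ?B) (P ?B \<union> A \<union> {b j})"
      using indep_self_imp[of "{b j}" "P ?B" "P ?B \<union> A \<union> {b j}"] flag[OF True] U by simp
    then have "I {b j} (P ?B \<union> A) (P ?B \<union> A \<union> {b j})"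
      using base_mono[of "{b j}" "P ?B" "P ?B \<union> A \<union> {b j}" A] U by auto
    then have "I {b j} (A \<union> (A \<union> P ?B)) {b j}"
      using mono_right[of "{b j}" "P ?B \<union> A" "P ?B \<union> A \<union> {b j}" "{b j}"] U
      by (simp add: Un_ac)
    then have "I {b j} A ((A \<union> P ?B) \<union> {b j})"
      using chain[of "{b j}" A "A \<union> P ?B" "{b j}"] free' U by simp
    then have "I {b j} A {b j}"
      using mono_right[of "{b j}" A "(A \<union> P ?B) \<union> {b j}" "{b j}"] U by simp
    then show ?thesis using indep_self_imp[of "{b j}" A "P J"] U by simp
  next
    case False
    then have E: "P ?E = P ?B" unfolding P_def by blast
    have AE: "A \<subseteq> S ?E" using A S_mono[OF subset_insertI[of ?B j]] by (rule subset_trans)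
    have bE: "b j \<in> S ?E" unfolding S_def by simp
    have "I (P J) (P ?B) (S ?E)"
      using free_over[OF initial_insert_below[OF j] order_refl EJ] E by simp
    then have "I (P J) (P ?B \<union> A) (S ?E)"
      using base_mono[of "P J" "P ?B" "S ?E" A] U AE by simp
    then have "I (P J) (P ?B \<union> A) {b j}"
      using mono_right[of "P J" "P ?B \<union> A" "S ?E" "{b j}"] U bE by simp
    then have "I {b j} (A \<union> (A \<union> P ?B)) (P J)"
      using sym[of "P J" "P ?B \<union> A" "{b j}"] U by (simp add: Un_ac)
    then have "I {b j} A ((A \<union> P ?B) \<union> P J)"
      using chain[of "{b j}" A "A \<union> P ?B" "P J"] free' U by simp
    then show ?thesis
      using mono_right[of "{b j}" A "(A \<union> P ?B) \<union> P J" "P J"] U by simp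
  qed
qed

end

section \<open>Automorphisms and elementary substructures\<close>

lemma finite_fv_trm: "finite (fv_trm t)"
  by (induction t) auto

lemma finite_fv: "finite (fv p)"
  by (induction p) (auto simp: finite_fv_trm)

lemma val_cong: "(\<And>n. n \<in> fv_trm t \<Longrightarrow> e n = e' n) \<Longrightarrow> val N e t = val N e' t"
proof (induction t)
  case (Fn f ts)
  then have "map (val N e) ts = map (val N e') ts" by fastforce
  then show ?case by (metis val.simps(2))
qed simp

lemma map_val_cong:
  "(\<And>n. n \<in> (\<Union>t\<in>set ts. fv_trm t) \<Longrightarrow> e n = e' n) \<Longrightarrow> map (val N e) ts = map (val N e') ts"
  by (auto intro: val_cong)

lemma sat_cong: "(\<And>n. n \<in> fv p \<Longrightarrow> e n = e' n) \<Longrightarrow> sat N e p = sat N e' p"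
proof (induction p arbitrary: e e')
  case (Eq s t)
  then show ?case using val_cong[of s e e' N] val_cong[of t e e' N] by simp
next
  case (Rel r ts)
  then show ?case using map_val_cong[of ts e e' N] by (simp only: sat.simps fv.simps)
next
  case (Exi n p)
  have "sat N (e(n := a)) p = sat N (e'(n := a)) p" for a
    by (rule Exi.IH) (use Exi.prems in auto)
  then show ?case by (simp only: sat.simps)
next
  case (Conj p q)
  then show ?case by (metis UnI1 UnI2 fv.simps(4) sat.simps(4))
next
  case (Neg p)
  then show ?case by (metis fv.simps(3) sat.simps(3))
qed

lemma val_in_dom:
  assumes "is_struc L N" "range e \<subseteq> dom N"
  shows "wf_trm L t \<Longrightarrow> val N e t \<in> dom N"
proof (induction t)
  case (Fn f ts)
  then have "map (val N e) ts \<in> lists (dom N)" by auto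
  then show ?case using Fn.prems assms(1) unfolding is_struc_def by simp
qed (use assms in auto)

lemma automorphism_val:
  assumes "is_struc L N" "automorphism L N \<sigma>" "range e \<subseteq> dom N"
  shows "wf_trm L t \<Longrightarrow> val N (\<sigma> \<circ> e) t = \<sigma> (val N e t)"
proof (induction t)
  case (Fn f ts)
  then have "map (val N (\<sigma> \<circ> e)) ts = map \<sigma> (map (val N e) ts)"
    by (auto simp: comp_def)
  moreover have "map (val N e) ts \<in> lists (dom N)"
    using Fn.prems val_in_dom[OF assms(1,3)] by auto
  ultimately show ?case using Fn.prems assms(2) unfolding automorphism_def
    by (metis length_map val.simps(2) wf_trm.simps(2))
qed simp

lemma automorphism_sat:
  assumes N: "is_struc L N" and \<sigma>: "automorphism L N \<sigma>"
  shows "wf_fm L p \<Longrightarrow> range e \<subseteq> dom N \<Longrightarrow> sat N (\<sigma> \<circ> e) p = sat N e p"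
proof (induction p arbitrary: e)
  case (Eq s t)
  have "inj_on \<sigma> (dom N)" using \<sigma> unfolding automorphism_def bij_betw_def by blast
  then show ?case
    using Eq automorphism_val[OF N \<sigma> Eq(2)] val_in_dom[OF N Eq(2)]
    by (simp add: inj_on_eq_iff comp_def)
next
  case (Rel r ts)
  have *: "map (val N (\<sigma> \<circ> e)) ts = map \<sigma> (map (val N e) ts)"
    using Rel automorphism_val[OF N \<sigma> Rel(2)] by auto
  have "map (val N e) ts \<in> lists (dom N)"
    using Rel val_in_dom[OF N Rel(2)] by auto
  then have "rint N r (map (val N e) ts) = rint N r (map \<sigma> (map (val N e) ts))"
    using \<sigma> Rel(1) unfolding automorphism_def by (metis length_map wf_fm.simps(2))
  then show ?case by (simp only: sat.simps *)
next
  case (Exi n p)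
  have im: "\<sigma> ` dom N = dom N" using \<sigma> unfolding automorphism_def bij_betw_def by blast
  have IH: "sat N ((\<sigma> \<circ> e)(n := \<sigma> a)) p = sat N (e(n := a)) p" if "a \<in> dom N" for a
  proof -
    have "(\<sigma> \<circ> e)(n := \<sigma> a) = \<sigma> \<circ> e(n := a)" by auto
    moreover have "range (e(n := a)) \<subseteq> dom N" using Exi.prems(2) that by (auto simp: image_subset_iff)
    ultimately show ?thesis using Exi.IH[of "e(n := a)"] Exi.prems(1) by (metis wf_fm.simps(5))
  qed
  have "sat N (\<sigma> \<circ> e) (Exi n p) \<longleftrightarrow> (\<exists>a\<in>\<sigma> ` dom N. sat N ((\<sigma> \<circ> e)(n := a)) p)"
    by (simp add: im)
  also have "\<dots> \<longleftrightarrow> (\<exists>a\<in>dom N. sat N (e(n := a)) p)"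
    using IH by blast
  finally show ?case by (simp only: sat.simps)
qed auto

lemma automorphism_comp:
  assumes "automorphism L N \<sigma>" "automorphism L N \<tau>"
  shows "automorphism L N (\<tau> \<circ> \<sigma>)"
proof -
  have "map \<sigma> xs \<in> lists (dom N)" if "xs \<in> lists (dom N)" for xs
  proof -
    have "bij_betw \<sigma> (dom N) (dom N)" using assms(1) unfolding automorphism_def by blast
    then show ?thesis using that bij_betwE by fastforce
  qed
  then show ?thesis
    using assms bij_betw_trans[of \<sigma> "dom N" "dom N" \<tau> "dom N"] unfolding automorphism_def
    by (metis (no_types, lifting) comp_apply length_map list.map_comp)
qed

lemma automorphism_inv:
  assumes N: "is_struc L N" and \<sigma>: "automorphism L N \<sigma>"
  shows "automorphism L N (inv_into (dom N) \<sigma>)"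
proof -
  let ?\<tau> = "inv_into (dom N) \<sigma>"
  have b: "bij_betw \<sigma> (dom N) (dom N)" using \<sigma> unfolding automorphism_def by blast
  have b': "bij_betw ?\<tau> (dom N) (dom N)" using b by (rule bij_betw_inv_into)
  have in_lists: "map ?\<tau> xs \<in> lists (dom N)" if "xs \<in> lists (dom N)" for xs
    using that bij_betwE[OF b'] by auto
  have inv: "map \<sigma> (map ?\<tau> xs) = xs" if "xs \<in> lists (dom N)" for xs
    using that b by (auto simp: bij_betw_inv_into_right intro!: map_idI)
  have "?\<tau> (fint N f xs) = fint N f (map ?\<tau> xs)"
    if h: "f \<in> funs L" "xs \<in> lists (dom N)" "length xs = far L f" for f xs
  proof -
    have "\<sigma> (fint N f (map ?\<tau> xs)) = fint N f xs"
      using \<sigma> h in_lists[OF h(2)] inv[OF h(2)] unfolding automorphism_def by (metis length_map)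
    moreover have "fint N f (map ?\<tau> xs) \<in> dom N"
      using N h in_lists[OF h(2)] unfolding is_struc_def by simp
    ultimately show ?thesis using b by (metis bij_betw_inv_into_left)
  qed
  moreover have "rint N r xs = rint N r (map ?\<tau> xs)"
    if h: "r \<in> rels L" "xs \<in> lists (dom N)" "length xs = rar L r" for r xs
    using \<sigma> h in_lists[OF h(2)] inv[OF h(2)] unfolding automorphism_def by (metis length_map)
  ultimately show ?thesis using b' unfolding automorphism_def by blast
qed

text \<open>
  \<open>b\<close> is the image of \<open>c\<close> under an automorphism that fixes \<open>A\<close> pointwise. In a strongly homogeneous
  structure and for small \<open>A\<close> this is equality of types over \<open>A\<close>; it makes it unnecessary to
  substitute parameters for free variables in formulas.
\<close>

definition conjugate ::
  "('f, 'r) lang \<Rightarrow> ('f, 'r, 'a) struc \<Rightarrow> 'a set \<Rightarrow> 'a \<Rightarrow> 'a \<Rightarrow> bool" where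
  "conjugate L N A c b \<longleftrightarrow> (\<exists>\<sigma>. automorphism L N \<sigma> \<and> (\<forall>a\<in>A. \<sigma> a = a) \<and> \<sigma> c = b)"

lemma conjugate_sym:
  assumes "is_struc L N" "A \<subseteq> dom N" "c \<in> dom N" "conjugate L N A c b"
  shows "conjugate L N A b c"
proof -
  obtain \<sigma> where \<sigma>: "automorphism L N \<sigma>" "\<forall>a\<in>A. \<sigma> a = a" "\<sigma> c = b"
    using assms(4) unfolding conjugate_def by blast
  then have "inj_on \<sigma> (dom N)" unfolding automorphism_def bij_betw_def by blast
  then have "inv_into (dom N) \<sigma> b = c" "\<forall>a\<in>A. inv_into (dom N) \<sigma> a = a"
    using \<sigma> assms(2,3) by (auto, metis inv_into_f_f subsetD)
  then show ?thesis using automorphism_inv[OF assms(1) \<sigma>(1)] unfolding conjugate_def by blast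
qed

lemma conjugate_trans:
  assumes "conjugate L N A c b" "conjugate L N A b d"
  shows "conjugate L N A c d"
proof -
  obtain \<sigma> \<tau> where "automorphism L N \<sigma>" "\<forall>a\<in>A. \<sigma> a = a" "\<sigma> c = b"
    "automorphism L N \<tau>" "\<forall>a\<in>A. \<tau> a = a" "\<tau> b = d"
    using assms unfolding conjugate_def by blast
  then show ?thesis
    unfolding conjugate_def by (intro exI[of _ "\<tau> \<circ> \<sigma>"]) (simp add: automorphism_comp)
qed

lemma conjugate_in_dom: "conjugate L N A c b \<Longrightarrow> c \<in> dom N \<Longrightarrow> b \<in> dom N"
  unfolding conjugate_def automorphism_def bij_betw_def by blast

text \<open>
  An automorphism that fixes \<open>A\<close> respects the constants naming the elements of \<open>A\<close>, so that
  \<open>automorphism_sat\<close> applies to formulas with parameters.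
\<close>

lemma automorphism_params:
  assumes \<sigma>: "automorphism L N \<sigma>" and A: "\<forall>a\<in>A. \<sigma> a = a"
  shows "automorphism (lang_params L A) (struc_params N) \<sigma>"
proof -
  have "\<sigma> (fint (struc_params N) f xs) = fint (struc_params N) f (map \<sigma> xs)"
    if "f \<in> funs (lang_params L A)" "xs \<in> lists (dom N)" "length xs = far (lang_params L A) f"
    for f xs
    using that \<sigma> A unfolding automorphism_def
    by (cases f) (auto simp: lang_params_def struc_params_def simp del: in_lists_conv_set)
  then show ?thesis
    using \<sigma> unfolding automorphism_def by (simp add: lang_params_def struc_params_def)
qed

lemma is_struc_params:
  assumes N: "is_struc L N" and A: "A \<subseteq> dom N"
  shows "is_struc (lang_params L A) (struc_params N)"
proof -
  have "fint (struc_params N) f xs \<in> dom N"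
    if "f \<in> funs (lang_params L A)" "xs \<in> lists (dom N)" "length xs = far (lang_params L A) f"
    for f xs
    using that N A unfolding is_struc_def
    by (cases f) (auto simp: lang_params_def struc_params_def simp del: in_lists_conv_set)
  then show ?thesis
    using N unfolding is_struc_def by (simp add: struc_params_def)
qed

lemma conjugate_realizes:
  assumes N: "is_struc L N" and A: "A \<subseteq> dom N" and c: "c \<in> dom N"
    and b: "conjugate L N A c b" and q: "q \<subseteq> fms1 L A" "realizes N c q"
  shows "realizes N b q"
  unfolding realizes_def
proof
  fix p assume p: "p \<in> q"
  obtain \<sigma> where \<sigma>: "automorphism L N \<sigma>" "\<forall>a\<in>A. \<sigma> a = a" "\<sigma> c = b"
    using b unfolding conjugate_def by blast
  have "\<sigma> \<circ> (\<lambda>_ :: nat. c) = (\<lambda>_. b)" using \<sigma>(3) by auto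
  moreover have "wf_fm (lang_params L A) p" and c_sat: "sat (struc_params N) (\<lambda>_. c) p"
    using p q unfolding fms1_def realizes_def by blast+
  moreover have "range (\<lambda>_ :: nat. c) \<subseteq> dom (struc_params N)"
    using c unfolding struc_params_def by auto
  ultimately have "sat (struc_params N) (\<lambda>_. b) p = sat (struc_params N) (\<lambda>_. c) p"
    using automorphism_sat[OF is_struc_params[OF N A] automorphism_params[OF \<sigma>(1,2)],
        of p "\<lambda>_. c"] by simp
  then show "sat (struc_params N) (\<lambda>_. b) p" using c_sat by blast
qed

lemma val_induced: "val (induced N M) e t = val N e t"
proof (induction t)
  case (Fn f ts)
  then have "map (val (induced N M) e) ts = map (val N e) ts" by simp
  then show ?case by (simp only: val.simps) (simp add: induced_def)
qed simp

text \<open>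
  A form of the Tarski--Vaught criterion. Closure under functions is included: the automorphism
  given for a value \<open>f(xs)\<close> over the entries of \<open>xs\<close> fixes that value.
\<close>

lemma elementary_if_conjugates:
  assumes N: "is_struc L N" and M: "M \<subseteq> dom N"
    and conj: "\<And>A c. finite A \<Longrightarrow> A \<subseteq> M \<Longrightarrow> c \<in> dom N \<Longrightarrow> \<exists>b\<in>M. conjugate L N A c b"
  shows "elem_substruc L (induced N M) N"
proof -
  have d: "dom (induced N M) = M" "fint (induced N M) = fint N" "rint (induced N M) = rint N"
    unfolding induced_def by simp_all
  have "M \<noteq> {}" using N conj[of "{}"] unfolding is_struc_def by blast
  moreover have "fint N f xs \<in> M"
    if h: "f \<in> funs L" "xs \<in> lists M" "length xs = far L f" for f xs
  proof -
    have xs: "xs \<in> lists (dom N)" using h M by auto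
    then have "fint N f xs \<in> dom N" using N h unfolding is_struc_def by blast
    then obtain \<sigma> where \<sigma>: "automorphism L N \<sigma>" "\<forall>a\<in>set xs. \<sigma> a = a" "\<sigma> (fint N f xs) \<in> M"
      using conj[of "set xs" "fint N f xs"] h unfolding conjugate_def by auto
    then have "\<sigma> (fint N f xs) = fint N f (map \<sigma> xs)"
      using h xs unfolding automorphism_def by blast
    also have "map \<sigma> xs = xs" using \<sigma>(2) by (simp add: map_idI)
    finally show ?thesis using \<sigma>(3) by simp
  qed
  ultimately have "is_struc L (induced N M)" unfolding is_struc_def d by blast
  then have "substruc L (induced N M) N" using N M unfolding substruc_def d by blast
  moreover have "sat (induced N M) e p = sat N e p" if "wf_fm L p" "range e \<subseteq> M" for p e
    using that
  proof (induction p arbitrary: e)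
    case (Eq s t)
    then show ?case by (simp add: val_induced)
  next
    case (Rel r ts)
    then show ?case by (simp add: val_induced[abs_def] d)
  next
    case (Exi n p)
    have upd: "range (e(n := a)) \<subseteq> M" if "a \<in> M" for a
      using Exi.prems(2) that by (auto simp: image_subset_iff)
    have "\<exists>b\<in>M. sat N (e(n := b)) p" if a: "a \<in> dom N" "sat N (e(n := a)) p" for a
    proof -
      obtain b \<sigma> where b: "b \<in> M" "automorphism L N \<sigma>" "\<forall>x\<in>e ` fv p. \<sigma> x = x" "\<sigma> a = b"
        using conj[of "e ` fv p" a] Exi.prems(2) a(1) finite_fv[of p]
        unfolding conjugate_def by blast
      have "range (e(n := a)) \<subseteq> dom N" using Exi.prems(2) M a by (auto simp: image_subset_iff)
      then have "sat N (\<sigma> \<circ> e(n := a)) p"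
        using automorphism_sat[OF N b(2), of p "e(n := a)"] a Exi.prems(1) by simp
      moreover have "sat N (\<sigma> \<circ> e(n := a)) p = sat N (e(n := b)) p"
        by (rule sat_cong) (use b in auto)
      ultimately show ?thesis using b(1) by blast
    qed
    moreover have "sat (induced N M) (e(n := b)) p = sat N (e(n := b)) p" if "b \<in> M" for b
      using Exi.IH[OF _ upd[OF that]] Exi.prems(1) by (simp only: wf_fm.simps)
    ultimately show ?case using M unfolding sat.simps d by blast
  qed auto
  ultimately show ?thesis unfolding elem_substruc_def d by blast
qed

section \<open>Counting\<close>

text \<open>\<open>exists_below n p\<close> binds the variables below \<open>n\<close> existentially in \<open>p\<close>.\<close>

primrec exists_below :: "nat \<Rightarrow> ('f, 'r) fm \<Rightarrow> ('f, 'r) fm" where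
  "exists_below 0 p = p"
| "exists_below (Suc n) p = Exi n (exists_below n p)"

lemma fv_exists_below: "fv (exists_below n p) = fv p - {..<n}"
proof (induction n)
  case (Suc n)
  then show ?case
    by (simp only: exists_below.simps fv.simps lessThan_Suc) (rule Diff_insert[symmetric])
next
  case 0
  show ?case by (simp only: exists_below.simps lessThan_0 Diff_empty)
qed

lemma wf_exists_below: "wf_fm L (exists_below n p) = wf_fm L p"
  by (induction n) simp_all

lemma exists_below_inject: "exists_below n p = exists_below n q \<longleftrightarrow> p = q"
  by (induction n) simp_all

text \<open>
  A formula is determined by its existential closure together with the number of quantifiers
  added, and \<open>T\<close> contains that sentence or its negation.
\<close>

lemma card_formulas:
  assumes T: "complete_theory L T" and X: "infinite X" "|T| \<le>o |X|"
  shows "|{p. wf_fm L p}| \<le>o |X|"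
proof -
  have "\<exists>n. fv p \<subseteq> {..<n}" for p :: "('a, 'b) fm"
    using finite_fv[of p] unfolding finite_nat_set_iff_bounded by blast
  then obtain b :: "('a, 'b) fm \<Rightarrow> nat" where b: "\<And>p. fv p \<subseteq> {..<b p}" by metis
  define code where "code p =
    (let s = exists_below (b p) p in (b p, if s \<in> T then (s, True) else (Neg s, False)))" for p
  have "inj_on code {p. wf_fm L p}"
    unfolding inj_on_def code_def Let_def
    by (auto split: if_splits simp: exists_below_inject)
  moreover have "code ` {p. wf_fm L p} \<subseteq> UNIV \<times> (T \<times> UNIV)"
  proof -
    have "exists_below (b p) p \<in> sentences L" if "wf_fm L p" for p
      using that b[of p] unfolding sentences_def by (auto simp: fv_exists_below wf_exists_below)
    then have "\<forall>p. wf_fm L p \<longrightarrow> exists_below (b p) p \<in> T \<or> Neg (exists_below (b p) p) \<in> T"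
      using T unfolding complete_theory_def by blast
    then show ?thesis
      unfolding code_def Let_def by (auto split: if_splits)
  qed
  ultimately have "|{p. wf_fm L p}| \<le>o |(UNIV :: nat set) \<times> (T \<times> (UNIV :: bool set))|"
    by (intro card_of_ordLeqI[of code]) auto
  also have "|(UNIV :: nat set) \<times> (T \<times> (UNIV :: bool set))| \<le>o |X|"
  proof -
    have "|UNIV :: nat set| \<le>o |X|" using X infinite_iff_card_of_nat by blast
    moreover have "|UNIV :: bool set| \<le>o |X|"
    proof (rule ordLeq_transitive)
      show "|UNIV :: bool set| \<le>o |UNIV :: nat set|"
        by (rule card_of_ordLeqI[of of_bool]) (auto simp: inj_on_def)
    qed (rule \<open>|UNIV :: nat set| \<le>o |X|\<close>)
    ultimately show ?thesis
      using X by (intro card_of_Sigma_ordLeq_infinite ballI) auto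
  qed
  finally show ?thesis .
qed

lemma card_Pow_mono:
  assumes "|X| \<le>o |Y|"
  shows "|Pow X| \<le>o |Pow Y|"
proof -
  obtain f where f: "inj_on f X" "f ` X \<subseteq> Y" using assms card_of_ordLeq[of X Y] by blast
  then have "inj_on ((`) f) (Pow X)" "((`) f) ` Pow X \<subseteq> Pow Y"
    by (auto intro: inj_on_image_Pow)
  then show ?thesis using card_of_ordLeq[of "Pow X" "Pow Y"] by blast
qed

lemma card_sequences:
  fixes B :: "'b set"
  assumes W: "infinite W" and B: "|B| \<le>o |W|"
  shows "|{e :: nat \<Rightarrow> 'b. range e \<subseteq> B}| \<le>o |Pow W|"
proof -
  let ?g = "\<lambda>e :: nat \<Rightarrow> 'b. range (\<lambda>n. (n, e n))"
  have "inj ?g" unfolding inj_on_def by (auto simp: set_eq_iff image_iff)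
  moreover have "?g ` {e. range e \<subseteq> B} \<subseteq> Pow (UNIV \<times> B)" by auto
  ultimately have "|{e :: nat \<Rightarrow> 'b. range e \<subseteq> B}| \<le>o |Pow ((UNIV :: nat set) \<times> B)|"
    by (intro card_of_ordLeqI[of ?g]) (auto intro: inj_on_subset)
  also have "|Pow ((UNIV :: nat set) \<times> B)| \<le>o |Pow W|"
    using W B infinite_iff_card_of_nat[of W]
    by (intro card_Pow_mono card_of_Sigma_ordLeq_infinite) auto
  finally show ?thesis .
qed

text \<open>The reason is that the cardinal \<open>2^(2^|W|)\<close> is its own \<open>|W|\<close>-th power.\<close>

lemma card_bounded_subsets:
  assumes W: "infinite W" and M: "|M| \<le>o |Pow (Pow W)|"
  shows "|{A. A \<subseteq> M \<and> |A| \<le>o |W|}| \<le>o |Pow (Pow W)|"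
proof -
  have "\<forall>A\<in>{A. A \<subseteq> M \<and> |A| \<le>o |W|}. \<exists>i. inj_on i A \<and> i ` A \<subseteq> W"
    using card_of_ordLeq[of _ W] by blast
  then obtain i where i: "\<And>A. A \<subseteq> M \<Longrightarrow> |A| \<le>o |W| \<Longrightarrow> inj_on (i A) A \<and> i A ` A \<subseteq> W"
    by (metis (mono_tags, lifting) mem_Collect_eq)
  obtain h where h: "inj_on h M" "h ` M \<subseteq> Pow (Pow W)"
    using M card_of_ordLeq[of M "Pow (Pow W)"] by blast
  \<comment> \<open>A subset \<open>A\<close>, injected into \<open>W\<close> by \<open>i A\<close>, is coded by the image together with a copy of \<open>h\<close>
    on it. The first component is needed since \<open>h\<close> may take the value \<open>{}\<close>.\<close>
  let ?code = "\<lambda>A. (i A ` A, SIGMA w : i A ` A. h (inv_into A (i A) w))"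
  have sub: "B \<subseteq> A" if AB: "A \<subseteq> M" "|A| \<le>o |W|" "B \<subseteq> M" "|B| \<le>o |W|" "?code A = ?code B" for A B
  proof
    fix x assume x: "x \<in> B"
    then have "i B x \<in> i A ` A" using AB(5) by blast
    then obtain y where y: "y \<in> A" "i B x = i A y" by blast
    have dec: "(SIGMA w : i D ` D. h (inv_into D (i D) w)) `` {i D z} = h z"
      if "inj_on (i D) D" "z \<in> D" for D z
      using that by (auto simp: Image_def)
    have "h x = (SIGMA w : i B ` B. h (inv_into B (i B) w)) `` {i B x}"
      using dec[of B x] x i[OF AB(3,4)] by simp
    also have "\<dots> = (SIGMA w : i A ` A. h (inv_into A (i A) w)) `` {i A y}"
      using arg_cong[OF AB(5), of snd] y(2) by (simp only: snd_conv)
    also have "\<dots> = h y"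
      using dec[of A y] y i[OF AB(1,2)] by simp
    finally have "x = y" using h(1) x y AB by (meson inj_onD subsetD)
    then show "x \<in> A" using y by simp
  qed
  have "inj_on ?code {A. A \<subseteq> M \<and> |A| \<le>o |W|}"
  proof (rule inj_onI)
    fix A B
    assume "A \<in> {A. A \<subseteq> M \<and> |A| \<le>o |W|}" "B \<in> {A. A \<subseteq> M \<and> |A| \<le>o |W|}" "?code A = ?code B"
    then show "A = B" using sub[of A B] sub[of B A] by auto
  qed
  moreover have "?code ` {A. A \<subseteq> M \<and> |A| \<le>o |W|} \<subseteq> Pow W \<times> Pow (W \<times> Pow W)"
  proof (rule image_subsetI)
    fix A assume A: "A \<in> {A. A \<subseteq> M \<and> |A| \<le>o |W|}"
    then have iA: "inj_on (i A) A" "i A ` A \<subseteq> W" using i by blast+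
    have "h (inv_into A (i A) w) \<subseteq> Pow W" if "w \<in> i A ` A" for w
      using inv_into_into[OF that] h(2) A by blast
    then show "?code A \<in> Pow W \<times> Pow (W \<times> Pow W)" using iA(2) by blast
  qed
  ultimately have "|{A. A \<subseteq> M \<and> |A| \<le>o |W|}| \<le>o |Pow W \<times> Pow (W \<times> Pow W)|"
    by (intro card_of_ordLeqI[of ?code]) blast+
  also have "|Pow W \<times> Pow (W \<times> Pow W)| \<le>o |Pow (Pow W)|"
  proof (intro card_of_Sigma_ordLeq_infinite ballI)
    show "|Pow W| \<le>o |Pow (Pow W)|" using card_of_Pow ordLess_imp_ordLeq by blast
    show "|Pow (W \<times> Pow W)| \<le>o |Pow (Pow W)|"
      using W card_of_Pow[of W] ordLess_imp_ordLeq
      by (intro card_Pow_mono card_of_Sigma_ordLeq_infinite) (auto simp: finite_Pow_iff card_of_mono1)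
  qed (use W in \<open>auto simp: finite_Pow_iff\<close>)
  finally show ?thesis .
qed

text \<open>
  The type of \<open>c\<close> over \<open>A\<close>, coded as a set of \<open>L\<close>-formulas with assignments to all their variables.
  The value \<open>None\<close> stands for \<open>c\<close> and \<open>Some a\<close> for \<open>a \<in> A\<close>.
\<close>

definition elementary_type ::
  "('f, 'r) lang \<Rightarrow> ('f, 'r, 'a) struc \<Rightarrow> 'a set \<Rightarrow> 'a \<Rightarrow> (('f, 'r) fm \<times> (nat \<Rightarrow> 'a option)) set" where
  "elementary_type L N A c =
     {(p, e). wf_fm L p \<and> range e \<subseteq> insert None (Some ` A) \<and> sat N (case_option c id \<circ> e) p}"

lemma finite_less_Cinfinite: "finite A \<Longrightarrow> Cinfinite r \<Longrightarrow> |A| <o r"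
  by (rule Cfinite_ordLess_Cinfinite) (simp_all add: cfinite_def Field_card_of card_of_card_order_on)

lemma Cinfinite_card_of: "infinite W \<Longrightarrow> Cinfinite |W|"
  by (simp add: cinfinite_def Field_card_of card_of_card_order_on)

lemma card_elementary_types:
  fixes A :: "'a set"
  assumes W: "infinite W" "|{p. wf_fm L p}| \<le>o |W|" "|A| \<le>o |W|"
  shows "|range (elementary_type L N A)| \<le>o |Pow (Pow W)|"
proof -
  let ?E = "{p. wf_fm L p} \<times> {e :: nat \<Rightarrow> 'a option. range e \<subseteq> insert None (Some ` A)}"
  have "|insert None (Some ` A)| \<le>o |W|"
  proof -
    have "|{None} \<union> Some ` A| \<le>o |W|"
    proof (rule Un_Cinfinite_bound)
      show "|{None}| \<le>o |W|"
        using finite_less_Cinfinite[OF _ Cinfinite_card_of[OF W(1)]] ordLess_imp_ordLeq by blast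
      show "|Some ` A| \<le>o |W|" using card_of_image W(3) ordLeq_transitive by blast
      show "Cinfinite |W|" using W(1) by (rule Cinfinite_card_of)
    qed
    then show ?thesis by simp
  qed
  then have "|{e :: nat \<Rightarrow> 'a option. range e \<subseteq> insert None (Some ` A)}| \<le>o |Pow W|"
    by (rule card_sequences[OF W(1)])
  moreover have "|{p. wf_fm L p}| \<le>o |Pow W|"
    using W(2) card_of_Pow ordLeq_ordLess_trans ordLess_imp_ordLeq by blast
  ultimately have "|?E| \<le>o |Pow W|"
    using W(1) by (intro card_of_Sigma_ordLeq_infinite ballI) (auto simp: finite_Pow_iff)
  then have "|Pow ?E| \<le>o |Pow (Pow W)|" by (rule card_Pow_mono)
  moreover have "range (elementary_type L N A) \<subseteq> Pow ?E"
    unfolding elementary_type_def by auto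
  ultimately show ?thesis by (rule ordLeq_transitive[OF card_of_mono1, rotated])
qed

lemma elementary_type_eq_imp_elem_map:
  assumes A: "A \<subseteq> dom N" and c: "c \<in> dom N" and b: "b \<in> dom N"
    and eq: "elementary_type L N A c = elementary_type L N A b"
  shows "elem_map L N (id(c := b)) (insert c A)" "\<forall>a\<in>A. (id(c := b)) a = a"
proof -
  have transfer: "sat N (case_option c id \<circ> e) p = sat N (case_option b id \<circ> e) p"
    if "wf_fm L p" "range e \<subseteq> insert None (Some ` A)" for p e
  proof -
    have "(p, e) \<in> elementary_type L N A c \<longleftrightarrow> (p, e) \<in> elementary_type L N A b" using eq by simp
    then show ?thesis using that unfolding elementary_type_def by simp
  qed
  \<comment> \<open>If \<open>c \<in> A\<close>, the formula \<open>x = c\<close> belongs to the type.\<close>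
  have "b = c" if "c \<in> A"
    using transfer[of "Eq (Var 0) (Var 1)" "\<lambda>n. if n = 0 then None else Some c"] that by auto
  then show fixes_A: "\<forall>a\<in>A. (id(c := b)) a = a" by auto
  have "sat N e p = sat N (id(c := b) \<circ> e) p" if p: "wf_fm L p" and e: "range e \<subseteq> insert c A" for p e
  proof -
    let ?e = "\<lambda>n. if e n = c then None else Some (e n)"
    have "case_option c id \<circ> ?e = e" "case_option b id \<circ> ?e = id(c := b) \<circ> e" by auto
    moreover have "range ?e \<subseteq> insert None (Some ` A)" using e by auto
    ultimately show ?thesis using transfer[OF p, of ?e] by simp
  qed
  then show "elem_map L N (id(c := b)) (insert c A)"
    using A b c unfolding elem_map_def by auto
qed

section \<open>Independence in a monster model\<close>

locale independent_monster =
  fixes L :: "('f, 'r) lang" and T :: "('f, 'r) fm set" and mon :: "'m rel"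
    and \<CC> :: "('f, 'r, 'a) struc" and I :: "'a set \<Rightarrow> 'a set \<Rightarrow> 'a set \<Rightarrow> bool"
  assumes complete: "complete_theory L T" and monster: "monster L T mon \<CC>"
    and independence: "independence L mon \<CC> I"
begin

lemma is_struc: "is_struc L \<CC>"
  using monster unfolding monster_def is_model_def by blast

lemma Cinfinite_mon: "Cinfinite mon"
  using monster unfolding monster_def strong_limit_def by blast

lemma small_sub_dom: "small mon \<CC> A \<Longrightarrow> A \<subseteq> dom \<CC>"
  unfolding small_def by blast

lemma small_Un: "small mon \<CC> A \<Longrightarrow> small mon \<CC> B \<Longrightarrow> small mon \<CC> (A \<union> B)"
  using Un_Cinfinite_bound_strict[OF _ _ Cinfinite_mon] unfolding small_def by auto

lemma small_finite: "finite A \<Longrightarrow> A \<subseteq> dom \<CC> \<Longrightarrow> small mon \<CC> A"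
  using finite_less_Cinfinite[OF _ Cinfinite_mon] unfolding small_def by auto

lemma card_Pow_less:
  assumes "|X| <o mon"
  shows "|Pow X| <o mon"
proof -
  obtain Y :: "'m set" where Y: "|X| =o |Y|" "|Y| <o mon"
    using assms internalize_card_of_ordLess[of X mon] by blast
  have "|Pow X| \<le>o |Pow Y|" using Y(1) ordIso_imp_ordLeq card_Pow_mono by blast
  moreover have "|Pow Y| <o mon"
    using Y(2) monster unfolding monster_def strong_limit_def by blast
  ultimately show ?thesis by (rule ordLeq_ordLess_trans)
qed

lemma elem_map_extends:
  assumes "small mon \<CC> A" "elem_map L \<CC> g A"
  obtains \<sigma> where "automorphism L \<CC> \<sigma>" "\<forall>a\<in>A. \<sigma> a = g a"
  using assms monster unfolding monster_def strongly_homogeneous_def by blast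

lemma equiv_over_extends:
  assumes "small mon \<CC> A" "small mon \<CC> B" "equiv_over L \<CC> B A' A"
  obtains \<sigma> where "automorphism L \<CC> \<sigma>" "\<forall>b\<in>B. \<sigma> b = b" "\<sigma> ` A = A'"
proof -
  obtain g where g: "elem_map L \<CC> g (A \<union> B)" "\<forall>b\<in>B. g b = b" "g ` A = A'"
    using assms(3) unfolding equiv_over_def by blast
  obtain \<sigma> where \<sigma>: "automorphism L \<CC> \<sigma>" "\<forall>a\<in>A \<union> B. \<sigma> a = g a"
    using elem_map_extends[OF small_Un[OF assms(1,2)] g(1)] .
  then have "\<sigma> ` A = A'" using g(3) by (simp add: image_def)
  then show ?thesis using that \<sigma> g(2) by simp
qed

lemma invariance:
  assumes "small mon \<CC> A" "small mon \<CC> B" "small mon \<CC> D" "automorphism L \<CC> \<sigma>" "I A B D"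
  shows "I (\<sigma> ` A) (\<sigma> ` B) (\<sigma> ` D)"
proof -
  have "\<forall>A B C \<sigma>. small mon \<CC> A \<and> small mon \<CC> B \<and> small mon \<CC> C \<and> automorphism L \<CC> \<sigma> \<and> I A B C
        \<longrightarrow> I (\<sigma> ` A) (\<sigma> ` B) (\<sigma> ` C)"
    using independence unfolding independence_def by (elim conjE)
  then show ?thesis using assms by blast
qed

lemma free_copy:
  assumes "small mon \<CC> A" "small mon \<CC> B" "small mon \<CC> D"
  obtains \<sigma> where "automorphism L \<CC> \<sigma>" "\<forall>b\<in>B. \<sigma> b = b" "I (\<sigma> ` A) B D"
proof -
  have "\<forall>A B C. small mon \<CC> A \<and> small mon \<CC> B \<and> small mon \<CC> C \<longrightarrow>
        (\<exists>A'. equiv_over L \<CC> B A' A \<and> I A' B C)"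
    using independence unfolding independence_def by (elim conjE)
  then obtain A' where A': "equiv_over L \<CC> B A' A" "I A' B D" using assms by blast
  then show ?thesis using that equiv_over_extends[OF assms(1,2) A'(1)] by metis
qed

lemma small_automorphism_image:
  assumes "small mon \<CC> A" "automorphism L \<CC> \<sigma>"
  shows "small mon \<CC> (\<sigma> ` A)"
proof -
  have "\<sigma> ` A \<subseteq> dom \<CC>"
    using assms unfolding small_def automorphism_def bij_betw_def by blast
  then show ?thesis
    using assms(1) card_of_image ordLeq_ordLess_trans unfolding small_def by blast
qed

text \<open>Extension gives a copy of \<open>A\<close> over \<open>B\<close> that is free over \<open>B\<close> from \<open>B\<close>; it is moved back to \<open>A\<close>.\<close>

lemma indep_base:
  assumes A: "small mon \<CC> A" and B: "small mon \<CC> B"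
  shows "I A B B"
proof -
  obtain \<sigma> where \<sigma>: "automorphism L \<CC> \<sigma>" "\<forall>b\<in>B. \<sigma> b = b" "I (\<sigma> ` A) B B"
    using free_copy[OF A B B] .
  let ?\<tau> = "inv_into (dom \<CC>) \<sigma>"
  have inj: "inj_on \<sigma> (dom \<CC>)" using \<sigma>(1) unfolding automorphism_def bij_betw_def by blast
  have "?\<tau> ` \<sigma> ` A = A" using inj small_sub_dom[OF A] by (rule inv_into_image_cancel)
  moreover have "?\<tau> ` \<sigma> ` B = B" using inj small_sub_dom[OF B] by (rule inv_into_image_cancel)
  moreover have "\<sigma> ` B = B" using \<sigma>(2) by simp
  moreover have "I (?\<tau> ` \<sigma> ` A) (?\<tau> ` B) (?\<tau> ` B)"
    using invariance[OF small_automorphism_image[OF A \<sigma>(1)] B B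
        automorphism_inv[OF is_struc \<sigma>(1)] \<sigma>(3)] .
  ultimately show ?thesis by simp
qed

lemma indep_calculus:
  assumes U: "small mon \<CC> U"
  shows "indep_calculus U I"
proof -
  have sm: "small mon \<CC> X" if "X \<subseteq> U" for X using small_subset[OF U that] .
  have norm: "\<forall>A B C. small mon \<CC> A \<and> small mon \<CC> B \<and> small mon \<CC> C \<and> I A C B \<longrightarrow> I (A \<union> C) C B"
    using independence unfolding independence_def by (elim conjE)
  have sym: "\<forall>A B C. small mon \<CC> A \<and> small mon \<CC> B \<and> small mon \<CC> C \<and> I A B C \<longrightarrow> I C B A"
    using independence unfolding independence_def by (elim conjE)
  have trans: "\<forall>A B C D. small mon \<CC> A \<and> small mon \<CC> B \<and> small mon \<CC> C \<and> small mon \<CC> D \<and>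
        B \<subseteq> C \<and> C \<subseteq> D \<longrightarrow> (I A B D \<longleftrightarrow> I A B C \<and> I A C D)"
    using independence unfolding independence_def by (elim conjE)
  have fin: "\<forall>A B C. small mon \<CC> A \<and> small mon \<CC> B \<and> small mon \<CC> C \<longrightarrow>
        (I A B C \<longleftrightarrow> (\<forall>A0. finite A0 \<and> A0 \<subseteq> A \<longrightarrow> I A0 B C))"
    using independence unfolding independence_def by (elim conjE)
  show ?thesis
  proof
    fix A B D :: "'a set"
    assume h: "A \<subseteq> U" "B \<subseteq> U" "D \<subseteq> U"
    show "I (A \<union> D) D B" if "I A D B" using norm sm h that by blast
    show "I D B A" if "I A B D" using sym sm h that by blast
    show "I A B D \<longleftrightarrow> (\<forall>A0. finite A0 \<and> A0 \<subseteq> A \<longrightarrow> I A0 B D)"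
      using fin sm[OF h(1)] sm[OF h(2)] sm[OF h(3)] by simp
  next
    fix A B D E :: "'a set"
    assume h: "A \<subseteq> U" "E \<subseteq> U" "B \<subseteq> D" "D \<subseteq> E"
    have s: "small mon \<CC> A" "small mon \<CC> B" "small mon \<CC> D" "small mon \<CC> E"
      using h sm by (meson subset_trans)+
    show "I A B E \<longleftrightarrow> I A B D \<and> I A D E"
      using trans[THEN spec[of _ A], THEN spec[of _ B], THEN spec[of _ D], THEN spec[of _ E]] s h
      by simp
  next
    fix A B :: "'a set"
    assume "A \<subseteq> U" "B \<subseteq> U"
    then show "I A B B" using indep_base sm by simp
  qed
qed

lemma elementary_type_eq_imp_conjugate:
  assumes A: "small mon \<CC> A" and "c \<in> dom \<CC>" "b \<in> dom \<CC>"
    and "elementary_type L \<CC> A c = elementary_type L \<CC> A b"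
  shows "conjugate L \<CC> A c b"
proof -
  note g = elementary_type_eq_imp_elem_map[OF small_sub_dom[OF A] assms(2-4)]
  have "small mon \<CC> (insert c A)"
    using small_Un[OF small_finite[of "{c}"] A] assms(2) by simp
  then obtain \<sigma> where "automorphism L \<CC> \<sigma>" "\<forall>a\<in>insert c A. \<sigma> a = (id(c := b)) a"
    using elem_map_extends[OF _ g(1)] by blast
  then show ?thesis using g(2) unfolding conjugate_def by auto
qed

lemma free_conjugate:
  assumes "c \<in> dom \<CC>" "small mon \<CC> A" "small mon \<CC> D"
  shows "\<exists>b. conjugate L \<CC> A c b \<and> I {b} A D"
proof -
  have "small mon \<CC> {c}" using small_finite[of "{c}"] assms(1) by simp
  then obtain \<sigma> where "automorphism L \<CC> \<sigma>" "\<forall>a\<in>A. \<sigma> a = a" "I (\<sigma> ` {c}) A D"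
    using free_copy[OF _ assms(2,3)] by blast
  then show ?thesis unfolding conjugate_def by auto
qed

lemma conjugate_indep:
  assumes "conjugate L \<CC> A c b" "c \<in> dom \<CC>" "small mon \<CC> A" "B \<subseteq> A" "I {c} B A"
  shows "I {b} B A"
proof -
  obtain \<sigma> where \<sigma>: "automorphism L \<CC> \<sigma>" "\<forall>a\<in>A. \<sigma> a = a" "\<sigma> c = b"
    using assms(1) unfolding conjugate_def by blast
  have "small mon \<CC> {c}" using small_finite[of "{c}"] assms(2) by simp
  then have "I (\<sigma> ` {c}) (\<sigma> ` B) (\<sigma> ` A)"
    using invariance \<sigma>(1) assms small_subset[OF assms(3,4)] by blast
  moreover have "\<sigma> ` A = A" "\<sigma> ` B = B" using \<sigma>(2) assms(4) by force+
  ultimately show ?thesis using \<sigma>(3) by simp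
qed

lemma type_realized:
  assumes "small mon \<CC> A" "q \<in> types1 L \<CC> A"
  obtains c where "c \<in> dom \<CC>" "realizes \<CC> c q"
  using assms monster unfolding monster_def saturated_def by blast

text \<open>
  A task is a triple \<open>(A, c, d)\<close>: realize the type of \<open>c\<close> over \<open>A\<close>, for the density property if
  \<open>d\<close> holds and for the extension property otherwise. Up to conjugacy, all tasks with
  \<open>|A| \<le> |W|\<close> over a set of size at most \<open>2^(2^|W|)\<close> can be listed along \<open>Pow (Pow W)\<close>.
\<close>

lemma exists_task_list:
  assumes W: "infinite W" "|{p. wf_fm L p}| \<le>o |W|"
    and M: "small mon \<CC> M" "|M| \<le>o |Pow (Pow W)|"
  shows "\<exists>en :: 'w set set \<Rightarrow> 'a set \<times> 'a \<times> bool.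
    (\<forall>t\<in>Pow (Pow W). fst (en t) \<subseteq> M \<and> fst (snd (en t)) \<in> dom \<CC>) \<and>
    (\<forall>A c d. A \<subseteq> M \<and> |A| \<le>o |W| \<and> c \<in> dom \<CC> \<longrightarrow>
      (\<exists>t\<in>Pow (Pow W). \<exists>c'. en t = (A, c', d) \<and> conjugate L \<CC> A c' c))"
proof -
  let ?\<Lambda> = "Pow (Pow W)"
  define Y where "Y = {A. A \<subseteq> M \<and> |A| \<le>o |W|} \<times> dom \<CC> \<times> (UNIV :: bool set)"
  define h where "h = (\<lambda>(A, c, d :: bool). (A, elementary_type L \<CC> A c, d))"
  have inf: "infinite ?\<Lambda>" using W(1) by (simp add: finite_Pow_iff)
  have bool: "|UNIV :: bool set| \<le>o |?\<Lambda>|"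
    by (rule ordLess_imp_ordLeq, rule finite_less_Cinfinite[OF finite Cinfinite_card_of[OF inf]])
  have "|SIGMA A : {A. A \<subseteq> M \<and> |A| \<le>o |W|}. range (elementary_type L \<CC> A) \<times> (UNIV :: bool set)|
      \<le>o |?\<Lambda>|"
    using inf bool card_bounded_subsets[OF W(1) M(2)] card_elementary_types[OF W]
    by (intro card_of_Sigma_ordLeq_infinite ballI) auto
  moreover have "h ` Y \<subseteq>
      (SIGMA A : {A. A \<subseteq> M \<and> |A| \<le>o |W|}. range (elementary_type L \<CC> A) \<times> UNIV)"
    unfolding Y_def h_def by auto
  ultimately have "|h ` Y| \<le>o |?\<Lambda>|" by (rule ordLeq_transitive[OF card_of_mono1, rotated])
  moreover have "h ` Y \<noteq> {}"
  proof -
    have "({}, c, True) \<in> Y" if "c \<in> dom \<CC>" for c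
      using that unfolding Y_def by (simp add: card_of_empty)
    then show ?thesis using is_struc unfolding is_struc_def by blast
  qed
  ultimately obtain g where g: "g ` ?\<Lambda> = h ` Y"
    using card_of_ordLeq2[of "h ` Y" ?\<Lambda>] by blast
  define en where "en t = inv_into Y h (g t)" for t
  have en: "en t \<in> Y" "h (en t) = g t" if "t \<in> ?\<Lambda>" for t
    using g that unfolding en_def by (auto intro!: inv_into_into f_inv_into_f)
  have hits: "\<exists>t\<in>?\<Lambda>. \<exists>c'. en t = (A, c', d) \<and> conjugate L \<CC> A c' c"
    if A: "A \<subseteq> M" "|A| \<le>o |W|" and c: "c \<in> dom \<CC>" for A c d
  proof -
    have "(A, c, d) \<in> Y" using A c unfolding Y_def by blast
    then obtain t where t: "t \<in> ?\<Lambda>" "g t = h (A, c, d)" using g by (metis imageE imageI)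
    then obtain c' where c': "en t = (A, c', d)" "elementary_type L \<CC> A c' = elementary_type L \<CC> A c"
      using en(2)[OF t(1)] unfolding h_def by (auto split: prod.splits)
    then have "c' \<in> dom \<CC>" using en(1)[OF t(1)] unfolding Y_def by simp
    then show ?thesis
      using elementary_type_eq_imp_conjugate[OF small_subset[OF M(1) A(1)] _ c c'(2)] t(1) c'(1)
      by blast
  qed
  have tasks: "fst (en t) \<subseteq> M \<and> fst (snd (en t)) \<in> dom \<CC>" if "t \<in> ?\<Lambda>" for t
    using en(1)[OF that] unfolding Y_def by auto
  show ?thesis
  proof (rule exI[of _ en], rule conjI)
    show "\<forall>t\<in>?\<Lambda>. fst (en t) \<subseteq> M \<and> fst (snd (en t)) \<in> dom \<CC>"
      using tasks by (rule ballI)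
    show "\<forall>A c d. A \<subseteq> M \<and> |A| \<le>o |W| \<and> c \<in> dom \<CC> \<longrightarrow>
        (\<exists>t\<in>?\<Lambda>. \<exists>c'. en t = (A, c', d) \<and> conjugate L \<CC> A c' c)"
      by (intro allI impI hits) simp_all
  qed
qed

lemma pair_is_model:
  assumes M: "elem_substruc L (induced \<CC> M) \<CC>"
  shows "is_model (lang2 L) (theory2 L T TYPE('a)) (pair_struc \<CC> M P)"
proof -
  have red: "reduct (pair_struc \<CC> M P) = induced \<CC> M"
    unfolding reduct_def pair_struc_def induced_def by simp
  have M_struc: "is_struc L (induced \<CC> M)" "M \<subseteq> dom \<CC>"
    using M unfolding elem_substruc_def substruc_def induced_def by auto
  have "sat (induced \<CC> M) e p" if "p \<in> T" "range e \<subseteq> M" for p e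
  proof -
    have "wf_fm L p" using that(1) complete unfolding complete_theory_def sentences_def by blast
    moreover have "sat \<CC> e p"
      using that M_struc(2) monster unfolding monster_def is_model_def by blast
    ultimately show ?thesis
      using M that(2) unfolding elem_substruc_def by (simp add: induced_def)
  qed
  then have "is_model L T (reduct (pair_struc \<CC> M P))"
    using M_struc unfolding red is_model_def by (simp add: induced_def)
  moreover have "is_struc (lang2 L) (pair_struc \<CC> M P)"
    using M_struc(1) unfolding is_struc_def lang2_def pair_struc_def induced_def by simp
  ultimately show ?thesis unfolding is_model_def theory2_def by blast
qed

end

section \<open>Construction of lovely pairs\<close>

context independent_monster
begin

theorem lovely_pair_over:
  fixes \<kappa> :: "'k rel"
  assumes \<kappa>: "Card_order \<kappa>" "cinfinite \<kappa>" "\<kappa> <o mon" "|T| <o \<kappa>"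
    and C: "small mon \<CC> C" "PC \<subseteq> C" and PC_closed: "\<And>x. x \<in> C \<Longrightarrow> I {x} PC {x} \<Longrightarrow> x \<in> PC"
  shows "\<exists>M P. lovely_pair L T mon \<CC> I \<kappa> M P \<and> C \<subseteq> M \<and> P \<inter> C = PC \<and> I P PC C"
proof -
  define W where "W = C <+> Field \<kappa>"
  define \<Lambda> where "\<Lambda> = Pow (Pow W)"
  have W: "infinite W" using \<kappa>(2) unfolding W_def cinfinite_def by simp
  have \<kappa>_W: "\<kappa> \<le>o |W|" unfolding W_def using \<kappa>(1) by (rule Card_order_Plus2)
  have W_mon: "|W| <o mon"
  proof -
    have "|Inl ` C :: ('a + 'k) set| <o mon"
      using C(1) card_of_image ordLeq_ordLess_trans unfolding small_def by blast
    moreover have "|Inr ` Field \<kappa> :: ('a + 'k) set| <o mon"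
      using card_of_image ordLess_Field[OF \<kappa>(3)] by (rule ordLeq_ordLess_trans)
    ultimately show ?thesis
      unfolding W_def Plus_def by (rule Un_Cinfinite_bound_strict[OF _ _ Cinfinite_mon])
  qed
  have formulas: "|{p. wf_fm L p}| \<le>o |W|"
    using ordLess_imp_ordLeq[OF ordLess_ordLeq_trans[OF \<kappa>(4) \<kappa>_W]]
    by (rule card_formulas[OF complete W])
  have \<Lambda>: "infinite \<Lambda>" unfolding \<Lambda>_def using W by (simp add: finite_Pow_iff)
  have \<Lambda>_mon: "|\<Lambda>| <o mon" unfolding \<Lambda>_def by (intro card_Pow_less W_mon)
  have Pow_\<Lambda>: "|Pow W| \<le>o |\<Lambda>|"
    unfolding \<Lambda>_def by (rule ordLess_imp_ordLeq[OF card_of_Pow])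
  have C_\<Lambda>: "|C| \<le>o |\<Lambda>|"
    using card_of_Plus1[of C "Field \<kappa>"] ordLess_imp_ordLeq[OF card_of_Pow[of W]] Pow_\<Lambda>
    unfolding W_def[symmetric] by (meson ordLeq_transitive)

  \<comment> \<open>There are \<open>\<kappa>\<^sup>+\<close> stages, so that a very small subset of the union lies in some stage. Each
    stage consists of \<open>|\<Lambda>|\<close> steps; \<open>J\<close> is the index set of the steps, ordered lexicographically
    by \<open>R\<close>. Neither a stage nor the union outgrows \<open>|\<Lambda>|\<close>.\<close>
  define K where "K = Field (cardSuc \<kappa>)"
  define s where "s = cardSuc \<kappa> - Id"
  define l where "l = |\<Lambda>| - Id"
  define J where "J = K \<times> \<Lambda>"
  define R where "R = (s <*lex*> l) \<inter> J \<times> J"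
  have Suc_order: "Card_order (cardSuc \<kappa>)" by (rule cardSuc_Card_order[OF \<kappa>(1)])
  have wo_s: "well_order_on K (cardSuc \<kappa>)"
    using Suc_order unfolding K_def by (rule card_order_on_well_order_on)
  have wo_l: "well_order_on \<Lambda> |\<Lambda>|" by (rule card_of_well_order_on)
  have s: "wf s" "trans s" "trans (cardSuc \<kappa>)" "antisym (cardSuc \<kappa>)"
    using wo_s trans_diff_Id
    unfolding s_def well_order_on_def linear_order_on_def partial_order_on_def preorder_on_def
    by blast+
  have l: "wf l" "trans l"
    using wo_l trans_diff_Id
    unfolding l_def well_order_on_def linear_order_on_def partial_order_on_def preorder_on_def
    by blast+
  have s_total: "(i, i') \<in> s \<or> (i', i) \<in> s" if "i \<in> K" "i' \<in> K" "i \<noteq> i'" for i i'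
    using wo_s that unfolding s_def well_order_on_def linear_order_on_def total_on_def by blast
  have l_total: "(t, t') \<in> l \<or> (t', t) \<in> l" if "t \<in> \<Lambda>" "t' \<in> \<Lambda>" "t \<noteq> t'" for t t'
    using wo_l that unfolding l_def well_order_on_def linear_order_on_def total_on_def by blast
  have wf_R: "wf R"
    using wf_lex_prod[OF s(1) l(1)] unfolding R_def by (rule wf_subset) blast
  have trans_R: "trans R"
    unfolding R_def by (rule trans_Int[OF trans_lex_prod[OF s(2) l(2)]]) (simp add: trans_def)
  have R_total: "(j, k) \<in> R \<or> (k, j) \<in> R" if "j \<in> J" "k \<in> J" "j \<noteq> k" for j k
    using that s_total[of "fst j" "fst k"] l_total[of "snd j" "snd k"]
    unfolding R_def J_def by (cases j; cases k) auto
  have "|K| \<le>o |Pow W|"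
  proof -
    have "cardSuc \<kappa> \<le>o |Pow W|"
      using ordLeq_ordLess_trans[OF \<kappa>_W card_of_Pow]
      by (rule cardSuc_least[OF \<kappa>(1) card_of_Card_order])
    then show ?thesis
      using card_of_Field_ordIso[OF Suc_order] unfolding K_def by (rule ordIso_ordLeq_trans[rotated])
  qed
  then have "|K| \<le>o |\<Lambda>|" using Pow_\<Lambda> by (rule ordLeq_transitive)
  then have J_\<Lambda>: "|J| \<le>o |\<Lambda>|"
    unfolding J_def using \<Lambda> by (intro card_of_Sigma_ordLeq_infinite ballI) (auto intro: card_of_mono1)
  have bounded: "small mon \<CC> (C \<union> h ` D)" "|C \<union> h ` D| \<le>o |\<Lambda>|"
    if D: "D \<subseteq> J" and h: "h ` D \<subseteq> dom \<CC>" for h :: "'k set \<times> ('a + 'k) set set \<Rightarrow> 'a" and D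
  proof -
    have "|h ` D| \<le>o |\<Lambda>|"
      using card_of_image[of h D] card_of_mono1[OF D] J_\<Lambda> by (meson ordLeq_transitive)
    then show le: "|C \<union> h ` D| \<le>o |\<Lambda>|"
      by (rule Un_Cinfinite_bound[OF C_\<Lambda> _ Cinfinite_card_of[OF \<Lambda>]])
    show "small mon \<CC> (C \<union> h ` D)"
      using ordLeq_ordLess_trans[OF le \<Lambda>_mon] small_sub_dom[OF C(1)] h unfolding small_def by blast
  qed

  define lists_tasks :: "'a set \<Rightarrow> (('a + 'k) set set \<Rightarrow> 'a set \<times> 'a \<times> bool) \<Rightarrow> bool" where
    "lists_tasks M h \<longleftrightarrow>
      (\<forall>t\<in>\<Lambda>. fst (h t) \<subseteq> M \<and> fst (snd (h t)) \<in> dom \<CC>) \<and>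
      (\<forall>A c d. A \<subseteq> M \<and> |A| \<le>o |W| \<and> c \<in> dom \<CC> \<longrightarrow>
        (\<exists>t\<in>\<Lambda>. \<exists>c'. h t = (A, c', d) \<and> conjugate L \<CC> A c' c))" for M h
  define en where "en M = (SOME h. lists_tasks M h)" for M
  have en: "lists_tasks M (en M)" if "small mon \<CC> M" "|M| \<le>o |\<Lambda>|" for M
  proof -
    have "\<exists>h. lists_tasks M h"
      using exists_task_list[OF W formulas that(1) that(2)[unfolded \<Lambda>_def]]
      unfolding lists_tasks_def \<Lambda>_def .
    then show ?thesis unfolding en_def by (rule someI_ex)
  qed
  have en_tasks: "fst (en M t) \<subseteq> M" "fst (snd (en M t)) \<in> dom \<CC>"
    if "small mon \<CC> M" "|M| \<le>o |\<Lambda>|" "t \<in> \<Lambda>" for M t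
    using en[OF that(1,2)] that(3) unfolding lists_tasks_def by blast+
  have en_hits: "\<exists>t\<in>\<Lambda>. \<exists>c'. en M t = (A, c', d) \<and> conjugate L \<CC> A c' c"
    if "small mon \<CC> M" "|M| \<le>o |\<Lambda>|" "A \<subseteq> M" "|A| \<le>o |W|" "c \<in> dom \<CC>" for M A c d
    using en[OF that(1,2)] that(3-5) unfolding lists_tasks_def by simp

  \<comment> \<open>\<open>stage j\<close> are the steps of the stages before that of \<open>j\<close>. The tasks carried out in a stage
    concern subsets of the universe at the beginning of that stage.\<close>
  define below where "below j = {k. (k, j) \<in> R}" for j
  define stage where "stage j = {k \<in> J. (fst k, fst j) \<in> s}" for j :: "'k set \<times> ('a + 'k) set set"
  have below_J: "below j \<subseteq> J" for j unfolding below_def R_def by blast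
  have stage_J: "stage j \<subseteq> J" for j unfolding stage_def by blast
  have stage_below: "stage j \<subseteq> below j" if "j \<in> J" for j
    using that unfolding stage_def below_def R_def by (cases j) auto
  \<comment> \<open>A value of \<open>g\<close> is a new element together with its membership in the predicate.\<close>
  define S where "S g D = C \<union> (fst \<circ> g) ` D"
    for g :: "'k set \<times> ('a + 'k) set set \<Rightarrow> 'a \<times> bool" and D
  define P where "P g D = PC \<union> (fst \<circ> g) ` {k \<in> D. snd (g k)}"
    for g :: "'k set \<times> ('a + 'k) set set \<Rightarrow> 'a \<times> bool" and D
  define task where "task g j = en (S g (stage j)) (snd j)" for g j
  \<comment> \<open>The new element carries out the task freely over everything before. It enters the predicate
    if it is in the closure of the predicate so far, and for a density task also if it is free
    from the universe so far over the predicate so far.\<close>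
  define step where "step g j r \<longleftrightarrow> (j \<in> J \<longrightarrow>
      conjugate L \<CC> (fst (task g j)) (fst (snd (task g j))) (fst r) \<and> fst r \<in> dom \<CC> \<and>
      I {fst r} (fst (task g j)) (S g (below j)) \<and>
      (snd r \<longleftrightarrow> I {fst r} (P g (below j)) {fst r} \<or>
        snd (snd (task g j)) \<and> I {fst r} (P g (below j)) (S g (below j))))" for g j r
  have "\<exists>g. \<forall>j. step g j (g j)"
  proof (rule dependent_wf_choice[OF wf_R])
    fix g h :: "'k set \<times> ('a + 'k) set set \<Rightarrow> 'a \<times> bool" and j r
    assume "\<And>k. (k, j) \<in> R \<Longrightarrow> g k = h k"
    then have eq: "g k = h k" if "k \<in> below j" for k using that unfolding below_def by blast
    have S_cong: "S g D = S h D" if "D \<subseteq> below j" for D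
      unfolding S_def using eq that by (intro arg_cong2[of _ _ _ _ "(\<union>)"] image_cong) auto
    have "{k \<in> below j. snd (g k)} = {k \<in> below j. snd (h k)}" using eq by auto
    then have "P g (below j) = P h (below j)"
      unfolding P_def using eq by (intro arg_cong2[of _ _ _ _ "(\<union>)"] image_cong) auto
    moreover have "task g j = task h j" if "j \<in> J"
      unfolding task_def using S_cong[OF stage_below[OF that]] by simp
    moreover have "S g (below j) = S h (below j)" by (rule S_cong) simp
    ultimately show "step g j r = step h j r" unfolding step_def by auto
  next
    fix j and g :: "'k set \<times> ('a + 'k) set set \<Rightarrow> 'a \<times> bool"
    assume prev: "\<And>k. (k, j) \<in> R \<Longrightarrow> step g k (g k)"
    show "\<exists>r. step g j r"
    proof (cases "j \<in> J")
      case True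
      have "fst (g k) \<in> dom \<CC>" if "k \<in> below j" for k
        using prev[of k] that below_J unfolding below_def step_def by blast
      then have sub: "(fst \<circ> g) ` below j \<subseteq> dom \<CC>" "(fst \<circ> g) ` stage j \<subseteq> dom \<CC>"
        using stage_below[OF True] by auto
      have small: "small mon \<CC> (S g (below j))" "small mon \<CC> (S g (stage j))"
        "|S g (stage j)| \<le>o |\<Lambda>|"
        unfolding S_def using bounded[OF below_J sub(1)] bounded[OF stage_J sub(2)] by blast+
      have t: "fst (task g j) \<subseteq> S g (stage j)" "fst (snd (task g j)) \<in> dom \<CC>"
        unfolding task_def using en_tasks[OF small(2,3), of "snd j"] True
        unfolding J_def by (simp_all add: mem_Times_iff)
      obtain b where b: "conjugate L \<CC> (fst (task g j)) (fst (snd (task g j))) b"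
        "I {b} (fst (task g j)) (S g (below j))"
        using free_conjugate[OF t(2) small_subset[OF small(2) t(1)] small(1)] by (elim exE conjE)
      have "b \<in> dom \<CC>" using conjugate_in_dom[OF b(1) t(2)] .
      then show ?thesis using b unfolding step_def
        by (intro exI[of _ "(b, I {b} (P g (below j)) {b} \<or>
          snd (snd (task g j)) \<and> I {b} (P g (below j)) (S g (below j)))"]) simp
    qed (simp add: step_def)
  qed
  then obtain g where g: "\<And>j. step g j (g j)" by blast
  define b where "b = fst \<circ> g"
  define p where "p = snd \<circ> g"
  have b_conj: "conjugate L \<CC> (fst (task g j)) (fst (snd (task g j))) (b j)"
    and b_dom: "b j \<in> dom \<CC>"
    and b_free: "I {b j} (fst (task g j)) (S g (below j))"
    and p_iff: "p j \<longleftrightarrow> I {b j} (P g (below j)) {b j} \<or>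
        snd (snd (task g j)) \<and> I {b j} (P g (below j)) (S g (below j))"
    if "j \<in> J" for j
    using g[of j] that unfolding step_def b_def p_def by simp_all
  have S_eq: "S g D = C \<union> b ` D" for D unfolding S_def b_def ..
  have P_eq: "P g D = PC \<union> b ` {j \<in> D. p j}" for D unfolding P_def b_def p_def by simp
  have S_small: "small mon \<CC> (S g D)" "|S g D| \<le>o |\<Lambda>|" if "D \<subseteq> J" for D
    unfolding S_eq using bounded[OF that, of b] b_dom that by blast+
  define U where "U = S g J"
  have U_small: "small mon \<CC> U" unfolding U_def using S_small(1) by blast
  interpret calc: indep_calculus U I by (rule indep_calculus[OF U_small])
  have sub_U: "{b j} \<subseteq> U" "S g D \<subseteq> U" "P g D \<subseteq> U" if "j \<in> J" "D \<subseteq> J" for j D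
    using that C(2) unfolding U_def S_eq P_eq by blast+
  interpret seq: free_sequence U I R J C PC b p below "S g" "P g"
  proof
    show "R \<subseteq> J \<times> J" unfolding R_def by blast
    show "C \<subseteq> U" "b ` J \<subseteq> U" unfolding U_def S_eq by blast+
    show "I {b j} (P g (below j)) (S g (below j))" if "j \<in> J" "p j" for j
      using p_iff[OF that(1)] that(2) calc.indep_self_imp[OF sub_U(1,3,2)[OF that(1) below_J]]
      by blast
    show "p j" if "j \<in> J" "I {b j} (P g (below j)) {b j}" for j
      using p_iff[OF that(1)] that(2) by blast
  qed (use below_def S_eq P_eq wf_R trans_R R_total C PC_closed in auto)

  let ?M = "S g J" and ?P = "P g J"
  have initial_stage: "seq.initial (stage j)" for j
  proof -
    have "k' \<in> stage j" if "k \<in> stage j" "k' \<in> below k" for k k'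
      using that transD[OF s(2), of "fst k'" "fst k" "fst j"]
      unfolding stage_def below_def R_def by (cases k; cases k') auto
    then show ?thesis unfolding seq.initial_def using stage_J by blast
  qed
  \<comment> \<open>By regularity of \<open>\<kappa>\<^sup>+\<close>, every task over a very small subset of the union is carried out.\<close>
  have hit: "\<exists>j\<in>J. \<exists>c'. A \<subseteq> S g (stage j) \<and> task g j = (A, c', d) \<and> conjugate L \<CC> A c (b j)"
    if A: "A \<subseteq> ?M" "|A| <o \<kappa>" and c: "c \<in> dom \<CC>" for A c d
  proof -
    have A_small: "small mon \<CC> A" using small_subset[OF S_small(1) A(1)] by blast
    define As where "As i = S g {k \<in> J. (fst k, i) \<in> s}" for i
    have "relChain (cardSuc \<kappa>) As"
    proof -
      have "(k, i') \<in> s" if "(i, i') \<in> cardSuc \<kappa>" "(k, i) \<in> s" for k i i'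
        using that s(3,4) unfolding s_def by (blast dest: transD antisymD)
      then show ?thesis unfolding relChain_def As_def S_eq by blast
    qed
    moreover have "A \<subseteq> (\<Union>i\<in>K. As i)"
    proof
      fix x assume "x \<in> A"
      then have x: "x \<in> C \<union> b ` J" using A(1) unfolding S_eq by blast
      have K: "infinite K" "K \<noteq> {}"
        using Cinfinite_cardSuc[of \<kappa>] \<kappa>(1,2) unfolding K_def cinfinite_def by auto
      show "x \<in> (\<Union>i\<in>K. As i)"
      proof (cases "x \<in> C")
        case True
        then show ?thesis using K(2) unfolding As_def S_eq by blast
      next
        case False
        then obtain k where k: "k \<in> J" "x = b k" using x by blast
        then have "fst k \<in> K" unfolding J_def by auto
        then obtain i where "i \<in> K" "(fst k, i) \<in> s"
          using infinite_Card_order_limit[OF Suc_order] K(1) unfolding K_def s_def by blast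
        then show ?thesis using k unfolding As_def S_eq by blast
      qed
    qed
    ultimately obtain i where i: "i \<in> K" "A \<subseteq> As i"
      using cardSuc_UNION_Cinfinite[of \<kappa> As A] \<kappa>(1,2) ordLess_imp_ordLeq[OF A(2)]
      unfolding K_def by blast
    have st: "stage (i, t) = {k \<in> J. (fst k, i) \<in> s}" for t unfolding stage_def by simp
    have "|A| \<le>o |W|" using ordLess_imp_ordLeq[OF ordLess_ordLeq_trans[OF A(2) \<kappa>_W]] .
    then obtain t c' where t: "t \<in> \<Lambda>" "en (As i) t = (A, c', d)" "conjugate L \<CC> A c' c"
      using en_hits[of "As i" A c d] i(2) c S_small[of "{k \<in> J. (fst k, i) \<in> s}"]
      unfolding As_def by blast
    have j: "(i, t) \<in> J" using i t unfolding J_def by blast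
    have task: "task g (i, t) = (A, c', d)" using t(2) unfolding task_def st As_def by simp
    have c': "c' \<in> dom \<CC>"
      using en_tasks(2)[of "As i" t] t S_small[of "{k \<in> J. (fst k, i) \<in> s}"]
      unfolding As_def by simp
    have "conjugate L \<CC> A c c'"
      using conjugate_sym[OF is_struc small_sub_dom[OF A_small] c' t(3)] .
    then have "conjugate L \<CC> A c (b (i, t))"
      using b_conj[OF j] unfolding task by (auto intro: conjugate_trans)
    then show ?thesis using i(2) j task unfolding As_def st[of t, symmetric] by blast
  qed
  have realized: "realizes \<CC> (b j) q"
    if "A \<subseteq> ?M" "q \<in> types1 L \<CC> A" "c \<in> dom \<CC>" "realizes \<CC> c q" "conjugate L \<CC> A c (b j)"
    for A q c j
  proof -
    have "A \<subseteq> dom \<CC>" using that(1) small_sub_dom[OF S_small(1)] by blast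
    then show ?thesis
      using conjugate_realizes[OF is_struc _ that(3,5) _ that(4)] that(2) unfolding types1_def by blast
  qed

  have density: "\<exists>x\<in>?P. realizes \<CC> x q"
    if A: "A \<subseteq> ?M" "|A| <o \<kappa>" and q: "q \<in> types1 L \<CC> A" and free: "type_indep \<CC> I q (?P \<inter> A) A"
    for A q
  proof -
    have A_small: "small mon \<CC> A" using small_subset[OF S_small(1) A(1)] by blast
    obtain c where c: "c \<in> dom \<CC>" "realizes \<CC> c q" "I {c} (?P \<inter> A) A"
      using free unfolding type_indep_def by blast
    obtain j c' where j: "j \<in> J" "A \<subseteq> S g (stage j)" "task g j = (A, c', True)"
      "conjugate L \<CC> A c (b j)"
      using hit[OF A c(1)] by blast
    have "I {b j} (?P \<inter> A) A"
      using conjugate_indep[OF j(4) c(1) A_small _ c(3)] by blast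
    then have "I {b j} (P g (below j)) (S g (below j))"
      using seq.density[OF j(1) initial_stage stage_below[OF j(1)] j(2)] b_free[OF j(1)] j(3) by simp
    then have "p j" using p_iff[OF j(1)] j(3) by simp
    then have "b j \<in> ?P" using j(1) unfolding P_eq by blast
    then show ?thesis using realized[OF A(1) q c(1,2) j(4)] by blast
  qed
  have extension: "\<exists>j\<in>J. conjugate L \<CC> A c (b j) \<and> I {b j} A ?P"
    if A: "A \<subseteq> ?M" "|A| <o \<kappa>" and c: "c \<in> dom \<CC>" for A c
  proof -
    obtain j c' where j: "j \<in> J" "A \<subseteq> S g (stage j)" "task g j = (A, c', False)"
      "conjugate L \<CC> A c (b j)"
      using hit[OF A c] by blast
    have "A \<subseteq> S g (below j)" using j(2) seq.S_mono[OF stage_below[OF j(1)]] by blast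
    then have "I {b j} A ?P"
      using seq.extension[OF j(1)] b_free[OF j(1)] p_iff[OF j(1)] j(3) by simp
    then show ?thesis using j by blast
  qed
  have \<kappa>_finite: "|A| <o \<kappa>" if "finite A" for A :: "'a set"
    using finite_less_Cinfinite[OF that] \<kappa>(1,2) by blast
  have elem: "elem_substruc L (induced \<CC> ?M) \<CC>"
  proof (rule elementary_if_conjugates[OF is_struc])
    show "?M \<subseteq> dom \<CC>" using small_sub_dom[OF S_small(1)] by blast
    show "\<exists>x\<in>?M. conjugate L \<CC> A c x" if "finite A" "A \<subseteq> ?M" "c \<in> dom \<CC>" for A c
      using extension[OF that(2) \<kappa>_finite[OF that(1)] that(3)] unfolding S_eq by blast
  qed
  have "lovely_pair L T mon \<CC> I \<kappa> ?M ?P"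
    unfolding lovely_pair_def
  proof (intro conjI allI impI)
    show "?P \<subseteq> ?M" by (rule seq.P_sub_S)
    show "is_model (lang2 L) (theory2 L T TYPE('a)) (pair_struc \<CC> ?M ?P)"
      by (rule pair_is_model[OF elem])
    show "small mon \<CC> ?M" by (rule S_small(1)) simp
    fix A q
    show "\<exists>x\<in>?P. realizes \<CC> x q"
      if "A \<subseteq> ?M \<and> |A| <o \<kappa> \<and> q \<in> types1 L \<CC> A \<and> type_indep \<CC> I q (?P \<inter> A) A"
      using density that by blast
    show "\<exists>x\<in>?M. realizes \<CC> x q \<and> I {x} A ?P"
      if h: "A \<subseteq> ?M \<and> |A| <o \<kappa> \<and> q \<in> types1 L \<CC> A"
    proof -
      have "small mon \<CC> A" using small_subset[OF S_small(1)] h by blast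
      then obtain c where c: "c \<in> dom \<CC>" "realizes \<CC> c q" using type_realized h by blast
      obtain j where j: "j \<in> J" "conjugate L \<CC> A c (b j)" "I {b j} A ?P"
        using extension[OF _ _ c(1)] h by blast
      then have "realizes \<CC> (b j) q" using realized[OF _ _ c] h by blast
      then show ?thesis using j unfolding S_eq by blast
    qed
  qed (rule elem)
  moreover have "C \<subseteq> ?M" unfolding S_eq by blast
  moreover have "?P \<inter> C = PC"
    using seq.trace[OF seq.initial_empty] unfolding S_eq[of "{}"] P_eq[of "{}"] by simp
  moreover have "I ?P PC C"
    using seq.free_over[OF seq.initial_empty order_refl] unfolding S_eq[of "{}"] P_eq[of "{}"] by simp
  ultimately show ?thesis by blast
qed

end

theorem lemma3p8:
  fixes L :: "('f, 'r) lang"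
    and T :: "('f, 'r) fm set"
    and mon :: "'m rel"
    and \<CC> :: "('f, 'r, 'a) struc"
    and I :: "'a set \<Rightarrow> 'a set \<Rightarrow> 'a set \<Rightarrow> bool"
    and \<kappa>0 :: "'m rel"
    and \<kappa> :: "'k rel"
  assumes "complete_theory L T"
    and "monster L T mon \<CC>"
    and "independence L mon \<CC> I"
    and "is_kappa0 mon \<CC> I \<kappa>0"
    and "Card_order \<kappa>" and "\<kappa> <o mon"
    and "\<kappa>0 <o \<kappa>" and "|T| <o \<kappa>"
  shows "(\<exists>M P. lovely_pair L T mon \<CC> I \<kappa> M P) \<and>
    (\<forall>C PC. PC \<subseteq> C \<and> small mon \<CC> C \<and> is_struc (lang2 L) (pair_struc \<CC> C PC) \<and>
        cl mon \<CC> I PC \<inter> C = PC \<longrightarrow>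
      (\<exists>M P. lovely_pair L T mon \<CC> I \<kappa> M P \<and>
        substruc (lang2 L) (pair_struc \<CC> C PC) (pair_struc \<CC> M P) \<and>
        I P PC C))"
proof -
  interpret independent_monster L T mon \<CC> I
    by (rule independent_monster.intro[OF assms(1-3)])
  have "cinfinite \<kappa>0" using assms(4) unfolding is_kappa0_def kappa0_property_def by blast
  then have \<kappa>: "cinfinite \<kappa>" by (rule cinfinite_mono[OF ordLess_imp_ordLeq[OF assms(7)]])
  note over = lovely_pair_over[OF assms(5) \<kappa> assms(6,8)]
  have "small mon \<CC> {}" by (rule small_finite) simp_all
  then have "\<exists>M P. lovely_pair L T mon \<CC> I \<kappa> M P" using over[of "{}" "{}"] by auto
  moreover have "\<exists>M P. lovely_pair L T mon \<CC> I \<kappa> M P \<and>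
        substruc (lang2 L) (pair_struc \<CC> C PC) (pair_struc \<CC> M P) \<and> I P PC C"
    if PC: "PC \<subseteq> C" and C: "small mon \<CC> C" "is_struc (lang2 L) (pair_struc \<CC> C PC)"
      and closed: "cl mon \<CC> I PC \<inter> C = PC" for C PC
  proof -
    have "x \<in> PC" if x: "x \<in> C" "I {x} PC {x}" for x
    proof -
      have "x \<in> dom \<CC>" using x(1) small_sub_dom[OF C(1)] by blast
      then have "small mon \<CC> {x}" using small_finite[of "{x}"] by simp
      then have "indep_ext mon \<CC> I {x} PC {x}"
        using indep_ext_iff[OF independence _ small_subset[OF C(1) PC]] x(2) by blast
      then show ?thesis using closed x(1) \<open>x \<in> dom \<CC>\<close> unfolding cl_def by blast
    qed
    then obtain M P where MP: "lovely_pair L T mon \<CC> I \<kappa> M P" "C \<subseteq> M" "P \<inter> C = PC" "I P PC C"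
      using over[OF C(1) PC] by blast
    have "is_struc (lang2 L) (pair_struc \<CC> M P)"
      using MP(1) unfolding lovely_pair_def is_model_def by blast
    moreover have "rint (pair_struc \<CC> C PC) r xs = rint (pair_struc \<CC> M P) r xs"
      if "xs \<in> lists C" for r xs
      using that MP(3) by (cases r) (auto simp: pair_struc_def)
    ultimately have "substruc (lang2 L) (pair_struc \<CC> C PC) (pair_struc \<CC> M P)"
      using C(2) MP(2) unfolding substruc_def by (auto simp: pair_struc_def simp del: in_lists_conv_set)
    then show ?thesis using MP by blast
  qed
  ultimately show ?thesis by blast
qed

end
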